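(* Let $d\geq 1$ and $n\geq d+1$ be integers, let $S=K[x_1,\ldots,x_n]$ be a polynomial ring over a field $K$, let $\bar G$ be the anti-$d$-path on the vertex set $\{1,\ldots,n\}$ and let $I=I(\bar G)\subset S$ be its edge ideal. Then for all $k>1$, $$\operatorname{Ass}_S(S/I^k)=\begin{cases}\operatorname{Ass}_S(S/I), & \text{if } d+2>n-d-1,\\ \operatorname{Ass}_S(S/I)\cup\{(x_1,\ldots,x_n)\}, & \text{if } d+2\leq n-d-1.\end{cases}$$ In particular, if $d+2>n-d-1$, then $I$ is normally torsion-free; otherwise, if $d+2\leq n-d-1$, then $I^2$ is a normally torsion-free ideal.
   Context: A $d$-path is the graph on $\{1,\ldots,n\}$ which is the union of the complete graphs on the vertex sets $\{1,\ldots,d+1\},\{2,\ldots,d+2\},\ldots,\{n-d,\ldots,n\}$. Its complementary graph $\bar G$ is called an anti-$d$-path, and its edge ideal is $I(\bar G)=(x_ix_j : 1\leq i,j\leq n,\ i+d<j)$. An ideal $J\subset S$ is called normally torsion-free if $\operatorname{Ass}_S(S/J)=\operatorname{Ass}_S(S/J^k)$ for all $k\geq 1$. *)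

theory Defs
  imports "HOL-Algebra.Module" "HOL-Algebra.QuotRing" "HOL-Algebra.Ideal_Product" "HOL-Library.Poly_Mapping"
begin

section \<open>The polynomial ring \<open>K[x\<^sub>1, \<dots>, x\<^sub>n]\<close>\<close>

text \<open>
  A polynomial is a finitely supported map from monomials to coefficients, and a monomial a finitely
  supported map from variable indices to exponents; multiplication on the outer
  \<^type>\<open>poly_mapping\<close> is convolution. The type has countably many variables, so
  \<open>K[x\<^sub>1, \<dots>, x\<^sub>n]\<close> is cut out by its carrier. This keeps \<open>n\<close> an ordinary natural number.
\<close>

type_synonym 'k mpoly = "(nat \<Rightarrow>\<^sub>0 nat) \<Rightarrow>\<^sub>0 'k"

definition polynomial_ring :: "nat \<Rightarrow> 'k::field mpoly ring" where
  "polynomial_ring n =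
    \<lparr> carrier = {p. \<forall>m \<in> Poly_Mapping.keys p. Poly_Mapping.keys m \<subseteq> {1..n}},
      mult = (*), one = 1, zero = 0, add = (+) \<rparr>"

definition pvar :: "nat \<Rightarrow> 'k::field mpoly" where
  "pvar i = Poly_Mapping.single (Poly_Mapping.single i 1) 1"

lemma polynomial_ring_cring: "cring (polynomial_ring n :: 'k::field mpoly ring)"
proof -
  let ?R = "polynomial_ring n :: 'k mpoly ring"
  have add_closed: "p + q \<in> carrier ?R" if "p \<in> carrier ?R" "q \<in> carrier ?R" for p q
    using that Poly_Mapping.keys_add[of p q] by (auto simp: polynomial_ring_def)
  have mult_closed: "p * q \<in> carrier ?R" if p: "p \<in> carrier ?R" and q: "q \<in> carrier ?R" for p q
  proof -
    have "Poly_Mapping.keys m \<subseteq> {1..n}" if "m \<in> Poly_Mapping.keys (p * q)" for m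
    proof -
      obtain a b where m: "m = a + b" "a \<in> Poly_Mapping.keys p" "b \<in> Poly_Mapping.keys q"
        using \<open>m \<in> Poly_Mapping.keys (p * q)\<close> Poly_Mapping.keys_mult[of p q] by blast
      then have "Poly_Mapping.keys a \<subseteq> {1..n}" "Poly_Mapping.keys b \<subseteq> {1..n}"
        using p q by (auto simp: polynomial_ring_def)
      then show ?thesis
        using m(1) Poly_Mapping.keys_add[of a b] by blast
    qed
    then show ?thesis
      by (simp add: polynomial_ring_def)
  qed
  have closed_0_1: "0 \<in> carrier ?R" "1 \<in> carrier ?R"
    by (auto simp: polynomial_ring_def)
  have minus_closed: "- p \<in> carrier ?R" if "p \<in> carrier ?R" for p
    using that by (simp add: polynomial_ring_def)
  have ops: "monoid.mult ?R = (*)" "ring.add ?R = (+)" "\<one>\<^bsub>?R\<^esub> = 1" "\<zero>\<^bsub>?R\<^esub> = 0"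
    by (simp_all add: polynomial_ring_def)
  show ?thesis
  proof (rule cringI)
    show "abelian_group ?R"
    proof (rule abelian_groupI)
      fix p assume "p \<in> carrier ?R"
      then show "\<exists>q\<in>carrier ?R. q \<oplus>\<^bsub>?R\<^esub> p = \<zero>\<^bsub>?R\<^esub>"
        by (intro bexI[of _ "- p"] minus_closed) (simp_all add: ops)
    qed (simp_all add: ops add_closed closed_0_1 ac_simps)
    show "Group.comm_monoid ?R"
      by (rule comm_monoidI) (simp_all add: ops mult_closed closed_0_1 ac_simps)
  qed (simp add: ops distrib_right)
qed

lemma pvar_closed:
  "1 \<le> i \<Longrightarrow> i \<le> n \<Longrightarrow> (pvar i :: 'k::field mpoly) \<in> carrier (polynomial_ring n)"
  by (simp add: polynomial_ring_def pvar_def)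


section \<open>Associated primes\<close>

definition annihilator_of :: "('a, 'r) ring_scheme \<Rightarrow> ('a, 'b, 'm) module_scheme \<Rightarrow> 'b \<Rightarrow> 'a set" where
  "annihilator_of R M m = {r \<in> carrier R. r \<odot>\<^bsub>M\<^esub> m = \<zero>\<^bsub>M\<^esub>}"

definition Ass :: "('a, 'r) ring_scheme \<Rightarrow> ('a, 'b, 'm) module_scheme \<Rightarrow> 'a set set" where
  "Ass R M = {P. primeideal P R \<and> (\<exists>m \<in> carrier M. P = annihilator_of R M m)}"

text \<open>\<open>R/I\<close> as an \<open>R\<close>-module: the quotient ring with scalars acting through \<open>R \<rightarrow> R/I\<close>.\<close>

definition quotient_module :: "('a, 'r) ring_scheme \<Rightarrow> 'a set \<Rightarrow> ('a, 'a set) module" where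
  "quotient_module R I =
    \<lparr> carrier = carrier (R Quot I), mult = mult (R Quot I), one = one (R Quot I),
      zero = zero (R Quot I), add = add (R Quot I),
      smult = (\<lambda>r c. (I +>\<^bsub>R\<^esub> r) \<otimes>\<^bsub>R Quot I\<^esub> c) \<rparr>"

lemma quotient_module_is_module:
  fixes R (structure)
  assumes "cring R" and "ideal I R"
  shows "module R (quotient_module R I)"
proof -
  interpret cring R by fact
  interpret I: ideal I R by fact
  interpret Q: cring "R Quot I"
    by (rule I.quotient_is_cring) fact
  note hom = I.rcos_ring_hom
  have closed: "I +> r \<in> carrier (R Quot I)" if "r \<in> carrier R" for r
    using ring_hom_closed[OF hom that] .
  show ?thesis
  proof (rule moduleI)
    show "abelian_group (quotient_module R I)"
    proof (rule abelian_groupI)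
      fix x assume "x \<in> carrier (quotient_module R I)"
      then show "\<exists>y\<in>carrier (quotient_module R I).
          y \<oplus>\<^bsub>quotient_module R I\<^esub> x = \<zero>\<^bsub>quotient_module R I\<^esub>"
        by (intro bexI[of _ "\<ominus>\<^bsub>R Quot I\<^esub> x"]) (simp_all add: quotient_module_def Q.l_neg)
    qed (simp_all add: quotient_module_def Q.a_ac)
  qed (auto simp: quotient_module_def closed Q.l_distr Q.r_distr Q.m_assoc \<open>cring R\<close>
      ring_hom_add[OF hom] ring_hom_mult[OF hom] ring_hom_one[OF hom])
qed

text \<open>Powers of ideals are taken in the multiplicative monoid \<^const>\<open>ideals_set\<close> of ideals.\<close>

abbreviation ideal_power :: "('a, 'r) ring_scheme \<Rightarrow> 'a set \<Rightarrow> nat \<Rightarrow> 'a set" where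
  "ideal_power R J k \<equiv> J [^]\<^bsub>ideals_set R\<^esub> k"

definition normally_torsion_free :: "('a, 'r) ring_scheme \<Rightarrow> 'a set \<Rightarrow> bool" where
  "normally_torsion_free R J \<longleftrightarrow>
    (\<forall>k\<ge>1. Ass R (quotient_module R J) = Ass R (quotient_module R (ideal_power R J k)))"


section \<open>Anti-\<open>d\<close>-paths and edge ideals\<close>

text \<open>Graphs are given by their edge sets, an edge being a two-element set of vertices.\<close>

definition complete_graph :: "nat set \<Rightarrow> nat set set" where
  "complete_graph V = {e. e \<subseteq> V \<and> card e = 2}"

definition graph_complement :: "nat set \<Rightarrow> nat set set \<Rightarrow> nat set set" where
  "graph_complement V E = complete_graph V - E"

definition d_path :: "nat \<Rightarrow> nat \<Rightarrow> nat set set" where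
  "d_path d n = (\<Union>i \<in> {1..n - d}. complete_graph {i..i + d})"

definition anti_d_path :: "nat \<Rightarrow> nat \<Rightarrow> nat set set" where
  "anti_d_path d n = graph_complement {1..n} (d_path d n)"

definition edge_ideal :: "nat \<Rightarrow> nat set set \<Rightarrow> 'k::field mpoly set" where
  "edge_ideal n E =
    Idl\<^bsub>polynomial_ring n\<^esub> {pvar i \<otimes>\<^bsub>polynomial_ring n\<^esub> pvar j | i j. {i, j} \<in> E}"

lemma doubleton_in_anti_d_path_iff:
  assumes "n \<ge> d + 1" and "i < j"
  shows "{i, j} \<in> anti_d_path d n \<longleftrightarrow> 1 \<le> i \<and> j \<le> n \<and> i + d < j"
proof -
  have "{i, j} \<in> d_path d n \<longleftrightarrow> j \<le> i + d" if "1 \<le> i" "j \<le> n"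
  proof
    assume le: "j \<le> i + d"
    let ?a = "min i (n - d)"
    have "?a \<in> {1..n - d}" "{i, j} \<subseteq> {?a..?a + d}"
      using assms that le by auto
    then show "{i, j} \<in> d_path d n"
      using assms(2) unfolding d_path_def complete_graph_def by (intro UN_I[of ?a]) auto
  qed (auto simp: d_path_def complete_graph_def)
  then show ?thesis
    using assms(2) by (auto simp: anti_d_path_def graph_complement_def complete_graph_def)
qed

lemma edge_ideal_anti_d_path:
  assumes "n \<ge> d + 1"
  shows "(edge_ideal n (anti_d_path d n) :: 'k::field mpoly set) =
    Idl\<^bsub>polynomial_ring n\<^esub> {pvar i \<otimes>\<^bsub>polynomial_ring n\<^esub> pvar j | i j.
      i \<in> {1..n} \<and> j \<in> {1..n} \<and> i + d < j}"
proof -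
  have comm: "(pvar i :: 'k mpoly) \<otimes>\<^bsub>polynomial_ring n\<^esub> pvar j = pvar j \<otimes>\<^bsub>polynomial_ring n\<^esub> pvar i"
    for i j by (simp add: polynomial_ring_def mult.commute)
  have ne: "i \<noteq> j" if "{i, j} \<in> anti_d_path d n" for i j
    using that by (auto simp: anti_d_path_def graph_complement_def complete_graph_def)
  have "{(pvar i :: 'k mpoly) \<otimes>\<^bsub>polynomial_ring n\<^esub> pvar j | i j. {i, j} \<in> anti_d_path d n} =
    {pvar i \<otimes>\<^bsub>polynomial_ring n\<^esub> pvar j | i j. i \<in> {1..n} \<and> j \<in> {1..n} \<and> i + d < j}"
    (is "?A = ?B")
  proof
    show "?A \<subseteq> ?B"
    proof
      fix p assume "p \<in> ?A"
      then obtain i j where p: "p = pvar i \<otimes>\<^bsub>polynomial_ring n\<^esub> pvar j"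
        and e: "{i, j} \<in> anti_d_path d n" by blast
      have e': "{j, i} \<in> anti_d_path d n"
        using e by (simp add: insert_commute)
      show "p \<in> ?B"
      proof (cases "i < j")
        case True
        with e doubleton_in_anti_d_path_iff[OF assms True] have "1 \<le> i" "j \<le> n" "i + d < j" by simp_all
        then have "i \<in> {1..n} \<and> j \<in> {1..n} \<and> i + d < j" by simp
        with p show ?thesis by blast
      next
        case False
        with ne[OF e] have less: "j < i" by simp
        with e' doubleton_in_anti_d_path_iff[OF assms less] have "1 \<le> j" "i \<le> n" "j + d < i" by simp_all
        then have "j \<in> {1..n} \<and> i \<in> {1..n} \<and> j + d < i" by simp
        with p comm[of i j] show ?thesis by blast
      qed
    qed
    show "?B \<subseteq> ?A"
    proof
      fix p assume "p \<in> ?B"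
      then obtain i j where p: "p = pvar i \<otimes>\<^bsub>polynomial_ring n\<^esub> pvar j"
        and ij: "i \<in> {1..n}" "j \<in> {1..n}" "i + d < j" by blast
      then have "{i, j} \<in> anti_d_path d n"
        using doubleton_in_anti_d_path_iff[OF assms, of i j] by simp
      with p show "p \<in> ?A" by blast
    qed
  qed
  then show ?thesis
    by (simp add: edge_ideal_def)
qed

end

theory Submission
  imports Defs "HOL-Library.Multiset"
begin

text \<open>
  The power \<open>I\<^sup>k\<close> is spanned by the monomials whose exponents have room for \<open>k\<close> edges, and an
  associated prime of a monomial ideal is generated by a set \<open>C\<close> of variables and is the colon ideal
  of a monomial \<open>u\<close>. So \<open>u\<close> has no room for \<open>k\<close> edges, an extra variable of \<open>C\<close> makes room, and no
  monomial in the other variables does. In particular \<open>C\<close> is a vertex cover. Let \<open>D\<close> be the set of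
  the vertices of \<open>C\<close> without a neighbour outside \<open>C\<close>. If some vertex lies outside \<open>C\<close>, or if
  \<open>n < 2 * d + 3\<close>, then \<open>D\<close> spans a bipartite graph. In a nonempty bipartite graph the largest
  packing of edges into \<open>u\<close> cannot grow with every single increment of \<open>u\<close>, hence \<open>D\<close> is empty and
  \<open>C\<close> is a minimal vertex cover. Otherwise \<open>C\<close> consists of all vertices and there is a triangle
  \<open>1, d + 2, n\<close>, which makes the maximal ideal associated to all powers from the second on.
\<close>


section \<open>Packing edges into a capacity function\<close>

definition edge_degree :: "('a \<times> 'a) multiset \<Rightarrow> 'a \<Rightarrow> nat" where
  "edge_degree M v = count (image_mset fst M) v + count (image_mset snd M) v"

text \<open>These are capacitated b-matchings. \<open>M\<close> is a multiset because a product of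
  generators may repeat an edge; the condition on degrees says that such a product divides the
  monomial with exponents \<open>u\<close>.\<close>

definition packable :: "('a \<times> 'a) set \<Rightarrow> nat \<Rightarrow> ('a \<Rightarrow> nat) \<Rightarrow> bool" where
  "packable E k u \<longleftrightarrow> (\<exists>M. size M = k \<and> set_mset M \<subseteq> E \<and> (\<forall>v. edge_degree M v \<le> u v))"

lemma edge_degree_simps [simp]:
  "edge_degree {#} v = 0"
  "edge_degree (add_mset e M) v
    = (if v = fst e then 1 else 0) + (if v = snd e then 1 else 0) + edge_degree M v"
  "edge_degree (M + N) v = edge_degree M v + edge_degree N v"
  by (simp_all add: edge_degree_def)

lemma edge_degree_replicate [simp]:
  "edge_degree (replicate_mset k e) v
    = (if v = fst e then k else 0) + (if v = snd e then k else 0)"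
  by (induction k) auto

lemma edge_degree_mono: "M \<subseteq># N \<Longrightarrow> edge_degree M v \<le> edge_degree N v"
  by (metis edge_degree_simps(3) le_add1 subset_mset.add_diff_inverse)

lemma edge_degree_pos_iff: "0 < edge_degree M v \<longleftrightarrow> (\<exists>e\<in>#M. fst e = v \<or> snd e = v)"
  by (induction M) auto

lemma packable_mono:
  assumes "packable E k u" "\<And>v. u v \<le> w v"
  shows "packable E k w"
  using assms unfolding packable_def by (blast intro: order_trans)

lemma packable_le:
  assumes "packable E k u" "j \<le> k"
  shows "packable E j u"
proof -
  obtain M where M: "size M = k" "set_mset M \<subseteq> E" "\<And>v. edge_degree M v \<le> u v"
    using assms(1) by (auto simp: packable_def)
  obtain es where "mset es = M" using ex_mset by blast
  with assms(2) M(1) have N: "mset (take j es) \<subseteq># M" "size (mset (take j es)) = j"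
    by (metis append_take_drop_id mset_append mset_subset_eq_add_left, force)
  have "edge_degree (mset (take j es)) v \<le> u v" for v
    using edge_degree_mono[OF N(1)] M(3) order_trans by blast
  moreover have "set_mset (mset (take j es)) \<subseteq> E"
    using set_mset_mono[OF N(1)] M(2) by blast
  ultimately show ?thesis
    using N(2) unfolding packable_def by blast
qed

lemma packable_add:
  assumes "packable E j u" "packable F k w" "E \<subseteq> G" "F \<subseteq> G"
  shows "packable G (j + k) (\<lambda>v. u v + w v)"
proof -
  obtain M N where "size M = j" "set_mset M \<subseteq> E" "\<And>v. edge_degree M v \<le> u v"
    "size N = k" "set_mset N \<subseteq> F" "\<And>v. edge_degree N v \<le> w v"
    using assms(1,2) by (auto simp: packable_def)
  with assms(3,4) show ?thesis
    unfolding packable_def by (intro exI[of _ "M + N"]) (auto intro: add_mono)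
qed

lemma packable_replicate:
  assumes "e \<in> E" "k \<le> u (fst e)" "k \<le> u (snd e)" "fst e \<noteq> snd e"
  shows "packable E k u"
  using assms unfolding packable_def
  by (intro exI[of _ "replicate_mset k e"]) (auto split: if_splits)

text \<open>Weak duality between packings and vertex covers: every edge adds at least one to the
  degrees on a cover.\<close>

lemma size_le_sum_edge_degree:
  assumes "finite C" "\<And>e. e \<in># M \<Longrightarrow> fst e \<in> C \<or> snd e \<in> C"
  shows "size M \<le> (\<Sum>c\<in>C. edge_degree M c)"
  using assms(2)
proof (induction M)
  case (add e M)
  then have "fst e \<in> C \<or> snd e \<in> C" "size M \<le> (\<Sum>c\<in>C. edge_degree M c)" by simp_all
  then show ?case using assms(1) by (auto simp: sum.distrib)
qed simp

lemma sum_edge_degree_side: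
  assumes "finite A" "\<And>e. e \<in># M \<Longrightarrow> fst e \<in> A \<and> snd e \<notin> A"
  shows "(\<Sum>c\<in>A. edge_degree M c) = size M"
  using assms(2)
proof (induction M)
  case (add e M)
  then show ?case using add.prems[of e] assms(1) by (auto simp: sum.distrib)
qed simp

lemma sum_edge_degree_total:
  assumes "finite A" "\<And>e. e \<in># M \<Longrightarrow> fst e \<in> A \<and> snd e \<in> A"
  shows "(\<Sum>c\<in>A. edge_degree M c) = 2 * size M"
  using assms(2)
proof (induction M)
  case (add e M)
  then show ?case using add.prems[of e] assms(1) by (auto simp: sum.distrib)
qed simp

text \<open>Every unit of capacity in \<open>W\<close> is spent on its own edge towards
  \<open>Z\<close>. Several vertices may choose the same partner, so each vertex of \<open>Z\<close>
  gets room for all of these edges.\<close>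

lemma packable_star_sum:
  assumes "finite W" "\<And>w. w \<in> W \<Longrightarrow> \<exists>z\<in>Z. (w, z) \<in> E \<or> (z, w) \<in> E"
  shows "packable E (sum u W) (\<lambda>v. (if v \<in> W then u v else 0) + (if v \<in> Z then sum u W else 0))"
  using assms
proof (induction W)
  case empty
  show ?case by (auto simp: packable_def)
next
  case (insert w W)
  obtain z where z: "z \<in> Z" "(w, z) \<in> E \<or> (z, w) \<in> E"
    using insert.prems by blast
  then obtain e where e: "e \<in> E" "e = (w, z) \<or> e = (z, w)" by blast
  have "packable E (u w) (\<lambda>v. (if v = w then u w else 0) + (if v \<in> Z then u w else 0))"
    unfolding packable_def using e z(1)
    by (intro exI[of _ "replicate_mset (u w) e"]) (auto split: if_splits)
  from packable_add[OF this insert.IH order_refl order_refl] insert.prems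
  have "packable E (u w + sum u W) (\<lambda>v. (if v = w then u w else 0) + (if v \<in> Z then u w else 0)
      + ((if v \<in> W then u v else 0) + (if v \<in> Z then sum u W else 0)))"
    by blast
  then show ?case
    using insert.hyps by (auto elim!: packable_mono)
qed


section \<open>Halving a bipartite packing\<close>

text \<open>For odd length the larger half is kept, which turns \<open>2 * r + 1\<close> pairs into
  \<open>r + 1\<close>.\<close>

fun alternate :: "'a list \<Rightarrow> 'a list" where
  "alternate (x # y # zs) = x # alternate zs"
| "alternate xs = xs"

lemma set_alternate: "set (alternate xs) \<subseteq> set xs"
  by (induction xs rule: alternate.induct) auto

lemma map_alternate: "map f (alternate xs) = alternate (map f xs)"
  by (induction xs rule: alternate.induct) auto

lemma length_alternate: "length (alternate xs) = (length xs + 1) div 2"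
  by (induction xs rule: alternate.induct) auto

lemma count_alternate_sorted:
  fixes xs :: "'a::linorder list"
  assumes "sorted xs"
  shows "2 * count (mset (alternate xs)) v \<le> count (mset xs) v + 1"
  using assms
proof (induction xs rule: alternate.induct)
  case (1 x y zs)
  show ?case
  proof (cases "x = v \<and> y \<noteq> v")
    case True
    \<comment> \<open>Here the run of copies of \<open>v\<close> ends at \<open>x\<close>, so
      sortedness leaves none in \<open>zs\<close>; this is where the \<open>+ 1\<close> is
      used.\<close>
    with "1.prems" have "v \<notin> set zs" by (auto dest: order_antisym)
    then have "count (mset (alternate zs)) v = 0"
      using set_alternate[of zs] unfolding count_eq_zero_iff by auto
    with True show ?thesis by (simp only: alternate.simps mset.simps count_add_mset) simp
  next
    case False
    with 1 show ?thesis by auto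
  qed
qed auto

text \<open>A counting argument, with positions starting at 0. If the left and right ends in
  position \<open>i\<close> violated the bound, then at least \<open>i + 1\<close> edges would have
  their right end at most \<open>d\<close> above that left end. All of them would have smaller left
  ends, of which there are at most \<open>i\<close>.\<close>

lemma sort_pairs_less:
  fixes es :: "(nat \<times> nat) list"
  assumes "\<forall>(a, b)\<in>set es. a + d < b"
  shows "\<forall>(a, b)\<in>set (zip (sort (map fst es)) (sort (map snd es))). a + d < b"
proof -
  let ?as = "sort (map fst es)" and ?bs = "sort (map snd es)"
  have "?as ! i + d < ?bs ! i" if i: "i < length es" for i
  proof (rule ccontr)
    assume "\<not> ?as ! i + d < ?bs ! i"
    then have le: "?bs ! i \<le> ?as ! i + d" by simp
    have flt: "length (filter P (sort xs)) = length (filter P xs)" for P and xs :: "nat list"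
      by (metis mset_filter mset_sort size_mset)
    have "?bs ! j \<le> ?as ! i + d" if "j \<le> i" for j
      using sorted_nth_mono[OF sorted_sort that, of "map snd es"] i le by simp
    then have "{..i} \<subseteq> {j. j < length ?bs \<and> ?bs ! j \<le> ?as ! i + d}"
      using i by auto
    then have "card {..i} \<le> length (filter (\<lambda>b. b \<le> ?as ! i + d) ?bs)"
      unfolding length_filter_conv_card by (intro card_mono) auto
    also have "\<dots> = length (filter (\<lambda>e. snd e \<le> ?as ! i + d) es)"
      unfolding flt by (simp add: filter_map comp_def)
    also have "\<dots> = length (filter (\<lambda>e. snd e \<le> ?as ! i + d) (filter (\<lambda>e. fst e < ?as ! i) es))"
      using assms by (subst filter_filter) (rule arg_cong[where f = length], rule filter_cong, auto)
    also have "\<dots> \<le> length (filter (\<lambda>e. fst e < ?as ! i) es)"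
      by (rule length_filter_le)
    also have "\<dots> = length (filter (\<lambda>a. a < ?as ! i) ?as)"
      unfolding flt by (simp add: filter_map comp_def)
    also have "\<dots> \<le> card {..<i}"
      unfolding length_filter_conv_card
    proof (intro card_mono subsetI)
      fix j assume "j \<in> {j. j < length ?as \<and> ?as ! j < ?as ! i}"
      then show "j \<in> {..<i}"
        using sorted_nth_mono[OF sorted_sort, of i j "map fst es"] by (auto simp: not_less intro: ccontr)
    qed simp
    finally show False by simp
  qed
  then show ?thesis by (auto simp: set_zip)
qed

text \<open>Sorting the left and the right endpoints separately keeps all pairs edges. In the sorted list the
  copies of a vertex are consecutive, so every other pair uses at most half of them, rounded up.\<close>

lemma halve_bipartite_packing:
  fixes M :: "(nat \<times> nat) multiset"
  assumes size: "size M = 2 * r + 1" and M: "\<And>i j. (i, j) \<in># M \<Longrightarrow> i \<in> A \<and> j \<in> B \<and> i + d < j"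
    and disj: "A \<inter> B = {}" and deg: "\<And>v. edge_degree M v \<le> 2 * u v"
  shows "packable {(i, j). i \<in> A \<and> j \<in> B \<and> i + d < j} (r + 1) u"
proof -
  obtain es where es: "mset es = M" using ex_mset by blast
  have len: "length es = 2 * r + 1" using size es by auto
  define ps where "ps = zip (sort (map fst es)) (sort (map snd es))"
  have fst_ps: "map fst ps = sort (map fst es)" and snd_ps: "map snd ps = sort (map snd es)"
    by (simp_all add: ps_def)
  let ?N = "mset (alternate ps)"
  have "set_mset ?N \<subseteq> {(i, j). i \<in> A \<and> j \<in> B \<and> i + d < j}"
  proof safe
    fix i j assume "(i, j) \<in># ?N"
    then have ij: "(i, j) \<in> set ps" using set_alternate[of ps] by auto
    have "\<forall>(i, j)\<in>set es. i + d < j" using M es by auto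
    from bspec[OF sort_pairs_less[OF this] ij[unfolded ps_def]] show "i + d < j" by simp
    have "i \<in> set (map fst ps)" "j \<in> set (map snd ps)" using ij by force+
    then show "i \<in> A" "j \<in> B" using M es unfolding fst_ps snd_ps by auto
  qed
  moreover have "size ?N = r + 1"
    using len by (simp add: length_alternate ps_def)
  moreover have "edge_degree ?N v \<le> u v" for v
  proof -
    have 1: "2 * count (image_mset fst ?N) v \<le> count (image_mset fst M) v + 1"
      using count_alternate_sorted[of "sort (map fst es)" v]
      by (metis es map_alternate mset_map mset_sort sorted_sort fst_ps)
    have 2: "2 * count (image_mset snd ?N) v \<le> count (image_mset snd M) v + 1"
      using count_alternate_sorted[of "sort (map snd es)" v]
      by (metis es map_alternate mset_map mset_sort sorted_sort snd_ps)
    \<comment> \<open>Only one of the two counts is nonzero, so rounding up happens at most once and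
      parity absorbs it.\<close>
    have "v \<notin># image_mset fst M \<or> v \<notin># image_mset snd M"
      using M disj by fastforce
    then have "count (image_mset fst M) v = 0 \<or> count (image_mset snd M) v = 0"
      by (simp add: count_eq_zero_iff)
    then show ?thesis
      using 1 2 deg[of v] unfolding edge_degree_def by presburger
  qed
  ultimately show ?thesis
    unfolding packable_def by blast
qed

text \<open>This replaces the Koenig theorem. A packing of size \<open>r\<close> avoiding one copy of some
  \<open>a \<in> A\<close> and a packing of size \<open>r + 1\<close> using an extra copy of \<open>a\<close> together have
  degrees at most \<open>2 * u\<close>, and halving their union would give a packing of size \<open>r + 1\<close> into \<open>u\<close>.\<close>

lemma bipartite_packing_not_increasing_everywhere:
  fixes u :: "nat \<Rightarrow> nat" and A B :: "nat set" and d :: nat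
  defines "E \<equiv> {(i, j). i \<in> A \<and> j \<in> B \<and> i + d < j}"
  assumes fin: "finite A" and disj: "A \<inter> B = {}"
    and ne: "A \<union> B \<noteq> {}"
    and inc: "\<And>c. c \<in> A \<union> B \<Longrightarrow> packable E (r + 1) (u(c := u c + 1))"
  shows "packable E (r + 1) u"
proof -
  obtain c where c: "c \<in> A \<union> B" using ne by blast
  \<comment> \<open>The vertex \<open>c\<close> may lie in \<open>A\<close>, but any packing of
    positive size has a right end, so \<open>B\<close> is nonempty.\<close>
  obtain M0 where M0: "size M0 = r + 1" "set_mset M0 \<subseteq> E"
    using inc[OF c] by (auto simp: packable_def)
  then have "M0 \<noteq> {#}" by auto
  then obtain e0 where "e0 \<in># M0" by blast
  with M0(2) obtain b where b: "b \<in> B" by (auto simp: E_def)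
  then have "b \<notin> A" using disj by blast
  obtain M where M: "size M = r + 1" "set_mset M \<subseteq> E" "\<And>v. edge_degree M v \<le> (u(b := u b + 1)) v"
    using inc[of b] b by (auto simp: packable_def)
  have side: "fst e \<in> A \<and> snd e \<notin> A" if "e \<in> E" for e
    using that disj by (auto simp: E_def)
  show ?thesis
  proof (cases "edge_degree M b = 0")
    case True
    then have "edge_degree M v \<le> u v" for v using M(3)[of v] by (cases "v = b") auto
    then show ?thesis using M unfolding packable_def by blast
  next
    case False
    then obtain e where e: "e \<in># M" "fst e = b \<or> snd e = b" by (auto simp: edge_degree_pos_iff)
    define M' where "M' = M - {#e#}"
    have MM': "M = add_mset e M'" using e(1) by (simp add: M'_def)
    have M': "size M' = r" "set_mset M' \<subseteq> E" using M MM' by auto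
    have M'_deg: "edge_degree M' v \<le> u v" for v
      using M(3)[of v] e(2) unfolding MM' by (cases "v = b") auto
    \<comment> \<open>If \<open>M'\<close> filled \<open>A\<close>, the capacities on
      \<open>A\<close> would sum to at most \<open>r\<close>. But \<open>M\<close> has
      \<open>r + 1\<close> edges, each with one end in \<open>A\<close>, where it respects
      \<open>u\<close> because the extra unit is at \<open>b\<close>, outside
      \<open>A\<close>.\<close>
    have "\<exists>a\<in>A. edge_degree M' a < u a"
    proof (rule ccontr)
      assume "\<not> ?thesis"
      then have "(\<Sum>a\<in>A. u a) \<le> (\<Sum>a\<in>A. edge_degree M' a)"
        by (intro sum_mono) (simp add: not_less)
      also have "\<dots> = r"
        using sum_edge_degree_side[OF fin, of M'] side M' by blast
      also have "\<dots> < (\<Sum>a\<in>A. edge_degree M a)"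
        using sum_edge_degree_side[OF fin, of M] side M(1,2) by fastforce
      also have "\<dots> \<le> (\<Sum>a\<in>A. u a)"
      proof (rule sum_mono)
        fix a assume "a \<in> A"
        then show "edge_degree M a \<le> u a" using M(3)[of a] \<open>b \<notin> A\<close> by (auto split: if_splits)
      qed
      finally show False by simp
    qed
    then obtain a where a: "a \<in> A" "edge_degree M' a < u a" by blast
    obtain M'' where M'': "size M'' = r + 1" "set_mset M'' \<subseteq> E"
      "\<And>v. edge_degree M'' v \<le> (u(a := u a + 1)) v"
      using inc[of a] a(1) by (auto simp: packable_def)
    have "edge_degree (M' + M'') v \<le> 2 * u v" for v
      using M'_deg[of v] M''(3)[of v] a(2) by (cases "v = a") auto
    moreover have "i \<in> A \<and> j \<in> B \<and> i + d < j" if "(i, j) \<in># M' + M''" for i j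
      using that M'(2) M''(2) by (auto simp: E_def)
    moreover have "size (M' + M'') = 2 * r + 1" using M'(1) M''(1) by simp
    ultimately show ?thesis
      unfolding E_def using halve_bipartite_packing disj by blast
  qed
qed


section \<open>Monomial ideals\<close>

text \<open>Storing all exponents instead of generators turns membership into a test on the support.
  The result is an ideal when \<open>A\<close> is upward closed.\<close>

definition monomial_ideal :: "nat \<Rightarrow> (nat \<Rightarrow>\<^sub>0 nat) set \<Rightarrow> 'k::field mpoly set" where
  "monomial_ideal n A = {p \<in> carrier (polynomial_ring n). Poly_Mapping.keys p \<subseteq> A}"

text \<open>For \<open>C \<subseteq> {1..n}\<close> this is the prime ideal generated by the
  variables in \<open>C\<close>; the description by supports makes it comparable with colon
  ideals.\<close>

definition variable_ideal :: "nat \<Rightarrow> nat set \<Rightarrow> 'k::field mpoly set" where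
  "variable_ideal n C = monomial_ideal n {m. Poly_Mapping.keys m \<inter> C \<noteq> {}}"

definition upward_closed :: "'a::plus set \<Rightarrow> bool" where
  "upward_closed A \<longleftrightarrow> (\<forall>a\<in>A. \<forall>b. a + b \<in> A)"

text \<open>The condition on \<open>u\<close> says that the colon ideal of the monomial \<open>u\<close> is generated by the
  variables in \<open>C\<close>.\<close>

definition colon_variables :: "nat \<Rightarrow> (nat \<Rightarrow>\<^sub>0 nat) set \<Rightarrow> nat set \<Rightarrow> bool" where
  "colon_variables n A C \<longleftrightarrow> C \<subseteq> {1..n} \<and> (\<exists>u. Poly_Mapping.keys u \<subseteq> {1..n} \<and>
    (\<forall>v. Poly_Mapping.keys v \<subseteq> {1..n} \<longrightarrow> (u + v \<in> A \<longleftrightarrow> Poly_Mapping.keys v \<inter> C \<noteq> {})))"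

section \<open>Supports of polynomials and exponents\<close>

lemma polynomial_ring_ops [simp]:
  "x \<otimes>\<^bsub>polynomial_ring n\<^esub> y = x * y" "x \<oplus>\<^bsub>polynomial_ring n\<^esub> y = x + y"
  "\<one>\<^bsub>polynomial_ring n\<^esub> = 1" "\<zero>\<^bsub>polynomial_ring n\<^esub> = 0"
  by (simp_all add: polynomial_ring_def)

lemma carrier_polynomial_ring_iff:
  "p \<in> carrier (polynomial_ring n) \<longleftrightarrow> (\<forall>m\<in>Poly_Mapping.keys p. Poly_Mapping.keys m \<subseteq> {1..n})"
  by (simp add: polynomial_ring_def)

lemma keys_add_nat:
  fixes a b :: "'a \<Rightarrow>\<^sub>0 nat"
  shows "Poly_Mapping.keys (a + b) = Poly_Mapping.keys a \<union> Poly_Mapping.keys b"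
  by (auto simp: in_keys_iff lookup_add)

lemma poly_mapping_split_keys:
  fixes p :: "'a \<Rightarrow>\<^sub>0 'b::comm_monoid_add"
  obtains q r where "p = q + r" "Poly_Mapping.keys q = Poly_Mapping.keys p \<inter> X"
    "Poly_Mapping.keys r = Poly_Mapping.keys p - X"
proof
  let ?q = "Poly_Mapping.mapp (\<lambda>m c. c when m \<in> X) p"
  let ?r = "Poly_Mapping.mapp (\<lambda>m c. c when m \<notin> X) p"
  show "p = ?q + ?r"
    by (rule poly_mapping_eqI) (auto simp: lookup_add lookup_mapp when_def in_keys_iff)
  show "Poly_Mapping.keys ?q = Poly_Mapping.keys p \<inter> X"
    by (auto simp: in_keys_iff lookup_mapp when_def split: if_splits)
  show "Poly_Mapping.keys ?r = Poly_Mapping.keys p - X"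
    by (auto simp: in_keys_iff lookup_mapp when_def split: if_splits)
qed

lemma poly_mapping_sum_single:
  "p = (\<Sum>m\<in>Poly_Mapping.keys p. Poly_Mapping.single m (Poly_Mapping.lookup p m))"
  by (rule poly_mapping_eqI)
    (simp add: lookup_sum lookup_single when_def sum.delta in_keys_iff)

lemma monomial_induct [case_names zero add]:
  fixes v :: "'a \<Rightarrow>\<^sub>0 nat"
  assumes "P 0" and "\<And>v i. P v \<Longrightarrow> P (v + Poly_Mapping.single i 1)"
  shows "P v"
proof (induction v rule: update_induct)
  case const
  show ?case by (rule assms)
next
  case (update f a b)
  have "P (f + Poly_Mapping.single a b)"
  proof (induction b)
    case 0
    show ?case using update.IH by simp
  next
    case (Suc b)
    have "f + Poly_Mapping.single a (Suc b) = (f + Poly_Mapping.single a b) + Poly_Mapping.single a 1"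
      by (simp add: add.assoc single_add [symmetric])
    with assms(2)[OF Suc] show ?case by metis
  qed
  moreover have "Poly_Mapping.update a b f = f + Poly_Mapping.single a b"
    using update.hyps(1)
    by (intro poly_mapping_eqI) (auto simp: lookup_update lookup_add lookup_single when_def in_keys_iff)
  ultimately show ?case by simp
qed

text \<open>Multiplying by a monomial translates the support injectively, so no terms
  cancel.\<close>

lemma keys_single_times:
  fixes p :: "'k::field mpoly"
  shows "Poly_Mapping.keys (Poly_Mapping.single v 1 * p) = (\<lambda>m. v + m) ` Poly_Mapping.keys p"
proof -
  have 1: "Poly_Mapping.keys (Poly_Mapping.single v 1 * p) \<subseteq> (\<lambda>m. v + m) ` Poly_Mapping.keys p"
    using Poly_Mapping.keys_mult[of "Poly_Mapping.single v (1::'k)" p] by auto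
  have 2: "Poly_Mapping.single v (1::'k) * p
      = (\<Sum>m\<in>Poly_Mapping.keys p. Poly_Mapping.single (v + m) (Poly_Mapping.lookup p m))"
    by (subst (1) poly_mapping_sum_single) (simp add: sum_distrib_left mult_single)
  have "Poly_Mapping.lookup (Poly_Mapping.single v 1 * p) (v + m) = Poly_Mapping.lookup p m" for m
    unfolding 2 by (simp add: lookup_sum lookup_single when_def sum.delta in_keys_iff)
  then have "v + m \<in> Poly_Mapping.keys (Poly_Mapping.single v 1 * p)" if "m \<in> Poly_Mapping.keys p" for m
    using that by (simp add: in_keys_iff)
  with 1 show ?thesis by blast
qed

lemma single_closed:
  "Poly_Mapping.keys m \<subseteq> {1..n} \<Longrightarrow> Poly_Mapping.single m c \<in> carrier (polynomial_ring n)"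
  by (simp add: carrier_polynomial_ring_iff)

context
  fixes n :: nat and S :: "'k::field mpoly ring"
  assumes S: "S = polynomial_ring n"
begin

interpretation S: cring S
  unfolding S by (rule polynomial_ring_cring)

lemma ideal_memI:
  assumes J: "ideal J S" and p: "p \<in> carrier S"
    and mon: "\<And>m. m \<in> Poly_Mapping.keys p \<Longrightarrow> Poly_Mapping.single m 1 \<in> J"
  shows "p \<in> J"
proof -
  interpret J: ideal J S by fact
  have "(\<Sum>m\<in>X. Poly_Mapping.single m (Poly_Mapping.lookup p m)) \<in> J"
    if "finite X" "X \<subseteq> Poly_Mapping.keys p" for X
    using that
  proof (induction X)
    case empty
    then show ?case using J.zero_closed by (simp add: S)
  next
    case (insert m X)
    have "Poly_Mapping.single 0 (Poly_Mapping.lookup p m) * Poly_Mapping.single m 1 \<in> J"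
      using J.I_l_closed[OF mon, of m "Poly_Mapping.single 0 (Poly_Mapping.lookup p m)"] insert.prems
      by (simp add: S single_closed)
    then show ?case
      using J.a_closed[of "Poly_Mapping.single m (Poly_Mapping.lookup p m)"] insert
      by (simp add: S mult_single)
  qed
  from this[OF finite_keys order_refl] show ?thesis
    by (simp flip: poly_mapping_sum_single)
qed

lemma ideal_uminus_closed:
  assumes "ideal J S" "p \<in> J"
  shows "- p \<in> J"
  using ideal.I_l_closed[OF assms, of "- 1"] by (simp add: S carrier_polynomial_ring_iff)

lemma monomial_ideal_is_ideal:
  assumes "upward_closed A"
  shows "ideal (monomial_ideal n A) S"
proof (rule idealI)
  show "ring S" by (rule S.ring_axioms)
  let ?J = "monomial_ideal n A :: 'k mpoly set"
  have uminus: "- p \<in> ?J" if "p \<in> ?J" for p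
    using that by (simp add: monomial_ideal_def carrier_polynomial_ring_iff)
  have inv: "inv\<^bsub>add_monoid S\<^esub> p = - p" if "p \<in> ?J" for p
    unfolding a_inv_def [symmetric]
    by (rule S.minus_equality)
      (use that in \<open>simp_all add: S monomial_ideal_def carrier_polynomial_ring_iff\<close>)
  show "subgroup ?J (add_monoid S)"
  proof
    show "?J \<subseteq> carrier (add_monoid S)"
      by (auto simp: S monomial_ideal_def)
    show "\<one>\<^bsub>add_monoid S\<^esub> \<in> ?J"
      by (simp add: S monomial_ideal_def carrier_polynomial_ring_iff)
    fix p q assume p: "p \<in> ?J"
    show "inv\<^bsub>add_monoid S\<^esub> p \<in> ?J"
      using inv[OF p] uminus[OF p] by simp
    assume q: "q \<in> ?J"
    have "Poly_Mapping.keys (p + q) \<subseteq> A" "p + q \<in> carrier (polynomial_ring n)"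
      using p q Poly_Mapping.keys_add[of p q]
      unfolding monomial_ideal_def carrier_polynomial_ring_iff by blast+
    then show "p \<otimes>\<^bsub>add_monoid S\<^esub> q \<in> ?J"
      by (simp add: S monomial_ideal_def)
  qed
  fix p x assume p: "p \<in> ?J" and x: "x \<in> carrier S"
  have "Poly_Mapping.keys (x * p) \<subseteq> A"
  proof
    fix m assume "m \<in> Poly_Mapping.keys (x * p)"
    then obtain a b where "m = b + a" "b \<in> Poly_Mapping.keys p"
      using Poly_Mapping.keys_mult[of x p] by (auto simp: add.commute)
    then show "m \<in> A"
      using p assms by (auto simp: monomial_ideal_def upward_closed_def)
  qed
  then show "x \<otimes>\<^bsub>S\<^esub> p \<in> ?J"
    using S.m_closed[OF x, of p] p by (simp add: S monomial_ideal_def)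
  then show "p \<otimes>\<^bsub>S\<^esub> x \<in> ?J"
    by (simp add: S mult.commute)
qed

lemma single_mem_monomial_ideal_iff:
  "Poly_Mapping.single m (1::'k) \<in> monomial_ideal n A \<longleftrightarrow> Poly_Mapping.keys m \<subseteq> {1..n} \<and> m \<in> A"
  by (simp add: monomial_ideal_def carrier_polynomial_ring_iff)

text \<open>Products of elements expand into products of monomials. Conversely exponents never
  cancel, so both factors of a monomial in the variables \<open>1\<close> to \<open>n\<close>
  involve only these variables.\<close>

lemma ideal_prod_monomial_ideal:
  assumes "upward_closed A" "upward_closed B"
  shows "ideal_prod S (monomial_ideal n A) (monomial_ideal n B)
    = monomial_ideal n {a + b | a b. a \<in> A \<and> b \<in> B}" (is "?L = ?R")
proof
  have up: "upward_closed {a + b | a b. a \<in> A \<and> b \<in> B}"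
    unfolding upward_closed_def
  proof safe
    fix a b c assume "a \<in> A" "b \<in> B"
    then have "a + b + c = a + (b + c) \<and> a \<in> A \<and> b + c \<in> B"
      using assms(2) by (simp add: upward_closed_def add.assoc)
    then show "\<exists>a' b'. a + b + c = a' + b' \<and> a' \<in> A \<and> b' \<in> B" by blast
  qed
  interpret R: ideal ?R S
    using up by (rule monomial_ideal_is_ideal)
  have L: "ideal ?L S"
    using assms by (intro S.ideal_prod_is_ideal monomial_ideal_is_ideal)
  show "?L \<subseteq> ?R"
  proof
    fix x assume "x \<in> ?L"
    then show "x \<in> ?R"
    proof induction
      case (prod i j)
      then have "i \<otimes>\<^bsub>S\<^esub> j \<in> carrier S"
        by (intro S.m_closed) (simp_all add: S monomial_ideal_def)
      then show ?case
        using prod Poly_Mapping.keys_mult[of i j]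
        by (fastforce simp: S monomial_ideal_def)
    qed (rule R.a_closed)
  qed
  show "?R \<subseteq> ?L"
  proof
    fix p assume p: "p \<in> ?R"
    show "p \<in> ?L"
    proof (rule ideal_memI[OF L])
      show "p \<in> carrier S" using p by (simp add: S monomial_ideal_def)
      fix m assume m: "m \<in> Poly_Mapping.keys p"
      then obtain a b where ab: "m = a + b" "a \<in> A" "b \<in> B"
        using p by (auto simp: monomial_ideal_def)
      moreover have "Poly_Mapping.keys m \<subseteq> {1..n}"
        using p m by (auto simp: monomial_ideal_def carrier_polynomial_ring_iff)
      ultimately have "Poly_Mapping.single a (1::'k) \<otimes>\<^bsub>S\<^esub> Poly_Mapping.single b 1 \<in> ?L"
        by (intro ideal_prod.prod) (auto simp: single_mem_monomial_ideal_iff keys_add_nat)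
      then show "Poly_Mapping.single m 1 \<in> ?L"
        by (simp add: S mult_single ab(1))
    qed
  qed
qed


section \<open>Associated primes of monomial ideals\<close>

text \<open>Every element of the quotient is the coset of some \<open>f\<close>, and its annihilator
  is the colon ideal of \<open>J\<close> by \<open>f\<close>.\<close>

lemma Ass_quotient_module:
  assumes "ideal J S"
  shows "Ass S (quotient_module S J)
    = {P. primeideal P S \<and> (\<exists>f\<in>carrier S. P = {r \<in> carrier S. r * f \<in> J})}"
proof -
  interpret J: ideal J S by fact
  have "annihilator_of S (quotient_module S J) (J +>\<^bsub>S\<^esub> f) = {r \<in> carrier S. r * f \<in> J}"
    if f: "f \<in> carrier S" for f
  proof -
    have "J +>\<^bsub>S\<^esub> x = J \<longleftrightarrow> x \<in> J" if "x \<in> carrier S" for x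
      using that S.a_coset_join1[of J x] J.a_rcos_const[of x]
      by (metis J.a_rcos_self)
    moreover have "r \<otimes>\<^bsub>S\<^esub> f = r * f" "r * f \<in> carrier S" if "r \<in> carrier S" for r
      using S.m_closed[OF that f] by (simp_all add: S)
    ultimately have "rcoset_mult S J (J +>\<^bsub>S\<^esub> r) (J +>\<^bsub>S\<^esub> f) = J \<longleftrightarrow> r * f \<in> J"
      if "r \<in> carrier S" for r
      using that f by (simp add: J.rcoset_mult_add)
    then show ?thesis
      by (auto simp only: annihilator_of_def quotient_module_def FactRing_def module.simps ring.simps
          partial_object.simps monoid.simps)
  qed
  moreover have "carrier (quotient_module S J) = (\<lambda>f. J +>\<^bsub>S\<^esub> f) ` carrier S"
    by (auto simp: quotient_module_def FactRing_def A_RCOSETS_def')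
  ultimately show ?thesis
    by (auto simp: Ass_def)
qed


section \<open>Prime ideals generated by variables\<close>

lemma upward_closed_meets: "upward_closed {m :: nat \<Rightarrow>\<^sub>0 nat. Poly_Mapping.keys m \<inter> C \<noteq> {}}"
  by (auto simp: upward_closed_def keys_add_nat)

text \<open>Split off the terms of both factors that meet \<open>C\<close>. The product of the
  remainders lies in the ideal, yet none of its monomials meets \<open>C\<close>, so it is zero, and
  one remainder vanishes as there are no zero divisors.\<close>

lemma primeideal_variable_ideal: "primeideal (variable_ideal n C) S"
proof (rule primeidealI)
  let ?X = "{m :: nat \<Rightarrow>\<^sub>0 nat. Poly_Mapping.keys m \<inter> C \<noteq> {}}"
  show P: "ideal (variable_ideal n C) S"
    unfolding variable_ideal_def by (rule monomial_ideal_is_ideal[OF upward_closed_meets])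
  show "cring S" by (rule S.is_cring)
  have "1 \<notin> variable_ideal n C"
    by (simp add: variable_ideal_def monomial_ideal_def)
  moreover have "1 \<in> carrier S"
    by (simp add: S carrier_polynomial_ring_iff)
  ultimately show "carrier S \<noteq> variable_ideal n C" by blast
  fix g h assume gh: "g \<in> carrier S" "h \<in> carrier S" "g \<otimes>\<^bsub>S\<^esub> h \<in> variable_ideal n C"
  obtain g1 g2 where g: "g = g1 + g2" "Poly_Mapping.keys g1 = Poly_Mapping.keys g \<inter> ?X"
    "Poly_Mapping.keys g2 = Poly_Mapping.keys g - ?X"
    by (rule poly_mapping_split_keys)
  obtain h1 h2 where h: "h = h1 + h2" "Poly_Mapping.keys h1 = Poly_Mapping.keys h \<inter> ?X"
    "Poly_Mapping.keys h2 = Poly_Mapping.keys h - ?X"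
    by (rule poly_mapping_split_keys)
  have cl: "g1 \<in> variable_ideal n C" "g2 \<in> carrier S" "h1 \<in> variable_ideal n C" "h2 \<in> carrier S"
    using gh(1,2) g(2,3) h(2,3) by (auto simp: variable_ideal_def monomial_ideal_def S carrier_polynomial_ring_iff)
  have "g1 * h \<in> variable_ideal n C" "g2 * h1 \<in> variable_ideal n C"
    using ideal.I_r_closed[OF P cl(1) gh(2)] ideal.I_l_closed[OF P cl(3) cl(2)] by (simp_all add: S)
  then have "g1 * h + g2 * h1 \<in> variable_ideal n C"
    using additive_subgroup.a_closed[OF ideal.axioms(1)[OF P]] by (simp add: S)
  then have "- (g1 * h + g2 * h1) \<in> variable_ideal n C"
    by (rule ideal_uminus_closed[OF P])
  then have "g * h + - (g1 * h + g2 * h1) \<in> variable_ideal n C"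
    using gh(3) additive_subgroup.a_closed[OF ideal.axioms(1)[OF P]] by (simp add: S)
  moreover have "g * h + - (g1 * h + g2 * h1) = g2 * h2"
    by (simp add: g(1) h(1) algebra_simps)
  ultimately have "Poly_Mapping.keys (g2 * h2) \<subseteq> ?X"
    by (simp add: variable_ideal_def monomial_ideal_def)
  moreover have "Poly_Mapping.keys (g2 * h2) \<subseteq> - ?X"
    using Poly_Mapping.keys_mult[of g2 h2] g(3) h(3) by (fastforce simp: keys_add_nat)
  ultimately have "Poly_Mapping.keys (g2 * h2) = {}" by blast
  then have "g2 = 0 \<or> h2 = 0" by simp
  then show "g \<in> variable_ideal n C \<or> h \<in> variable_ideal n C"
    using g(1) h(1) cl by auto
qed

text \<open>A monomial whose support meets \<open>C\<close> is divisible by a variable from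
  \<open>C\<close>. This yields the maximal ideal in the form used in the theorem.\<close>

lemma variable_ideal_eq_genideal:
  assumes "C \<subseteq> {1..n}"
  shows "variable_ideal n C = Idl\<^bsub>S\<^esub> (pvar ` C)"
proof
  have sub: "pvar ` C \<subseteq> carrier S"
    using assms by (auto simp: S intro!: pvar_closed)
  have gen: "ideal (Idl\<^bsub>S\<^esub> (pvar ` C)) S"
    using sub by (rule S.genideal_ideal)
  have "ideal (variable_ideal n C) S"
    using primeideal_variable_ideal by (rule primeideal.axioms(1))
  moreover have "(pvar ` C :: 'k mpoly set) \<subseteq> variable_ideal n C"
    using assms by (auto simp: variable_ideal_def pvar_def single_mem_monomial_ideal_iff simp del: One_nat_def)
  ultimately show "Idl\<^bsub>S\<^esub> (pvar ` C) \<subseteq> variable_ideal n C"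
    by (rule S.genideal_minimal)
  show "variable_ideal n C \<subseteq> Idl\<^bsub>S\<^esub> (pvar ` C)"
  proof
    fix p :: "'k mpoly" assume p: "p \<in> variable_ideal n C"
    show "p \<in> Idl\<^bsub>S\<^esub> (pvar ` C)"
    proof (rule ideal_memI[OF gen])
      show "p \<in> carrier S" using p by (simp add: S variable_ideal_def monomial_ideal_def)
      fix m assume m: "m \<in> Poly_Mapping.keys p"
      then obtain i where i: "i \<in> C" "i \<in> Poly_Mapping.keys m"
        using p by (auto simp: variable_ideal_def monomial_ideal_def)
      let ?m = "m - Poly_Mapping.single i 1"
      have m_eq: "m = ?m + Poly_Mapping.single i 1"
        using i(2) by (intro poly_mapping_eqI)
          (auto simp: lookup_add lookup_minus lookup_single when_def in_keys_iff)
      have "Poly_Mapping.keys m \<subseteq> {1..n}"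
        using p m by (auto simp: variable_ideal_def monomial_ideal_def carrier_polynomial_ring_iff)
      then have "Poly_Mapping.keys ?m \<subseteq> {1..n}"
        using m_eq keys_add_nat[of ?m "Poly_Mapping.single i 1"] by auto
      then have "Poly_Mapping.single ?m (1::'k) \<otimes>\<^bsub>S\<^esub> pvar i \<in> Idl\<^bsub>S\<^esub> (pvar ` C)"
        using i(1) S.genideal_self[OF sub]
        by (intro ideal.I_l_closed[OF gen]) (auto simp: S single_closed)
      then show "Poly_Mapping.single m 1 \<in> Idl\<^bsub>S\<^esub> (pvar ` C)"
        using m_eq by (simp add: S pvar_def mult_single)
    qed
  qed
qed


text \<open>The witness is the coset of the monomial with exponents \<open>u\<close>: multiplication
  by it shifts supports, so its colon ideal can be read off monomial by monomial.\<close>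

lemma colon_variables_imp_Ass:
  assumes A: "upward_closed A" and C: "colon_variables n A C"
  shows "variable_ideal n C \<in> Ass S (quotient_module S (monomial_ideal n A))"
proof -
  obtain u where u: "Poly_Mapping.keys u \<subseteq> {1..n}"
    "\<And>v. Poly_Mapping.keys v \<subseteq> {1..n} \<Longrightarrow> u + v \<in> A \<longleftrightarrow> Poly_Mapping.keys v \<inter> C \<noteq> {}"
    using C by (auto simp: colon_variables_def)
  let ?f = "Poly_Mapping.single u (1::'k)"
  have f: "?f \<in> carrier S" using u(1) by (simp add: S single_closed)
  have "r * ?f \<in> monomial_ideal n A \<longleftrightarrow> r \<in> variable_ideal n C" if r: "r \<in> carrier S" for r
  proof -
    have "r * ?f \<in> carrier S" using S.m_closed[OF r f] by (simp add: S)
    moreover have "Poly_Mapping.keys (r * ?f) = (\<lambda>m. u + m) ` Poly_Mapping.keys r"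
      by (subst mult.commute) (rule keys_single_times)
    moreover have "u + m \<in> A \<longleftrightarrow> Poly_Mapping.keys m \<inter> C \<noteq> {}" if "m \<in> Poly_Mapping.keys r" for m
      using r that by (intro u(2)) (auto simp: S carrier_polynomial_ring_iff)
    ultimately show ?thesis
      using r by (auto simp: monomial_ideal_def variable_ideal_def S)
  qed
  then have "variable_ideal n C = {r \<in> carrier S. r * ?f \<in> monomial_ideal n A}"
    by (auto simp: variable_ideal_def monomial_ideal_def S)
  then show ?thesis
    using f primeideal_variable_ideal
    unfolding Ass_quotient_module[OF monomial_ideal_is_ideal[OF A]] by blast
qed

text \<open>Among the \<open>f\<close> with annihilator \<open>P\<close> pick one with the fewest monomials. Multiplying it by a
  monomial outside the prime \<open>P\<close> does not change the annihilator, hence by minimality moves none of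
  its monomials into the ideal: every monomial of \<open>f\<close> is annihilated by the same monomials as \<open>f\<close>.\<close>

lemma Ass_imp_colon_variables:
  assumes A: "upward_closed A" and P: "P \<in> Ass S (quotient_module S (monomial_ideal n A))"
  obtains C where "colon_variables n A C" "P = variable_ideal n C"
proof -
  let ?J = "monomial_ideal n A :: 'k mpoly set"
  let ?ann = "\<lambda>f. {r \<in> carrier S. r * f \<in> ?J}"
  have J: "ideal ?J S" by (rule monomial_ideal_is_ideal[OF A])
  note J_add = additive_subgroup.a_closed[OF ideal.axioms(1)[OF J], unfolded S polynomial_ring_ops]
  define F where "F = {f \<in> carrier S. P = ?ann f}"
  have prime: "primeideal P S" and "\<exists>f. f \<in> F"
    using P by (auto simp: Ass_quotient_module[OF J] F_def)
  define f where "f = arg_min (\<lambda>f. card (Poly_Mapping.keys f)) (\<lambda>f. f \<in> F)"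
  have "f \<in> F" and least: "\<And>g. g \<in> F \<Longrightarrow> card (Poly_Mapping.keys f) \<le> card (Poly_Mapping.keys g)"
    unfolding f_def using \<open>\<exists>f. f \<in> F\<close> by (auto intro: arg_min_nat_lemma[THEN conjunct1] arg_min_nat_le)
  then have f: "f \<in> carrier S" "P = ?ann f"
    unfolding F_def by (simp_all only: mem_Collect_eq)
  have P_iff: "r \<in> P \<longleftrightarrow> r \<in> carrier S \<and> r * f \<in> ?J" for r
    by (subst f(2)) simp
  interpret P: primeideal P S by (rule prime)
  \<comment> \<open>Deleting from \<open>g\<close> its monomials in \<open>A\<close> keeps the
    annihilator; as \<open>g\<close> already has the fewest monomials, nothing was deleted.\<close>
  have disj: "Poly_Mapping.keys g \<inter> A = {}"
    if g: "g \<in> carrier S" "P = ?ann g" "card (Poly_Mapping.keys g) = card (Poly_Mapping.keys f)" for g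
  proof -
    obtain g1 g2 where s: "g = g1 + g2" "Poly_Mapping.keys g1 = Poly_Mapping.keys g \<inter> A"
      "Poly_Mapping.keys g2 = Poly_Mapping.keys g - A"
      by (rule poly_mapping_split_keys)
    have g12: "g1 \<in> ?J" "g2 \<in> carrier S"
      using g(1) s by (auto simp: monomial_ideal_def S carrier_polynomial_ring_iff)
    have "r * g \<in> ?J \<longleftrightarrow> r * g2 \<in> ?J" if r: "r \<in> carrier S" for r
    proof -
      have rg: "r * g1 \<in> ?J" using ideal.I_l_closed[OF J g12(1) r] by (simp add: S)
      have "r * g = r * g1 + r * g2" "r * g2 = - (r * g1) + r * g"
        by (simp_all add: s(1) algebra_simps)
      then show ?thesis
        using J_add rg ideal_uminus_closed[OF J rg] by metis
    qed
    then have "?ann g = ?ann g2" by (intro Collect_cong) blast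
    with g(2) have "P = ?ann g2" by (rule trans)
    with g12(2) have "g2 \<in> F" unfolding F_def by (intro CollectI conjI)
    then have "card (Poly_Mapping.keys g) \<le> card (Poly_Mapping.keys g2)"
      using least g(3) by metis
    moreover have "Poly_Mapping.keys g2 \<subseteq> Poly_Mapping.keys g" using s(3) by blast
    ultimately have "Poly_Mapping.keys g2 = Poly_Mapping.keys g"
      by (simp add: card_seteq)
    then show ?thesis using s(3) by blast
  qed
  have colon: "u + v \<in> A \<longleftrightarrow> Poly_Mapping.single v 1 \<in> P"
    if u: "u \<in> Poly_Mapping.keys f" and v: "Poly_Mapping.keys v \<subseteq> {1..n}" for u v
  proof -
    let ?x = "Poly_Mapping.single v (1::'k)"
    have x: "?x \<in> carrier S" using v by (simp add: S single_closed)
    have xf: "?x * f \<in> carrier S" using S.m_closed[OF x f(1)] by (simp add: S)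
    have uv: "u + v \<in> Poly_Mapping.keys (?x * f)"
      unfolding keys_single_times using u by (metis add.commute imageI)
    show ?thesis
    proof (cases "?x \<in> P")
      case True
      then have "?x * f \<in> ?J" using P_iff by simp
      then show ?thesis using uv True unfolding monomial_ideal_def by blast
    next
      case False
      have "r \<in> P \<longleftrightarrow> r * (?x * f) \<in> ?J" if r: "r \<in> carrier S" for r
      proof -
        have "r * (?x * f) \<in> ?J \<longleftrightarrow> r \<otimes>\<^bsub>S\<^esub> ?x \<in> P"
          using S.m_closed[OF r x] unfolding P_iff by (simp add: S mult.assoc)
        also have "\<dots> \<longleftrightarrow> r \<in> P"
          using P.I_prime[OF r x] P.I_r_closed[OF _ x] False by blast
        finally show ?thesis by simp
      qed
      then have "P = ?ann (?x * f)"
        by (metis (no_types, lifting) P.Icarr Collect_cong Collect_mem_eq)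
      moreover have "card (Poly_Mapping.keys (?x * f)) = card (Poly_Mapping.keys f)"
        unfolding keys_single_times by (rule card_image) simp
      ultimately have "Poly_Mapping.keys (?x * f) \<inter> A = {}"
        by (rule disj[OF xf])
      then show ?thesis using uv False by blast
    qed
  qed
  define C where "C = {i \<in> {1..n}. (pvar i :: 'k mpoly) \<in> P}"
  \<comment> \<open>Since \<open>P\<close> is prime, a monomial lies in it exactly when one of its
    variables does.\<close>
  have single_P: "Poly_Mapping.single v 1 \<in> P \<longleftrightarrow> Poly_Mapping.keys v \<inter> C \<noteq> {}"
    if "Poly_Mapping.keys v \<subseteq> {1..n}" for v
    using that
  proof (induction v rule: monomial_induct)
    case zero
    have "1 \<notin> P" using P.one_imp_carrier P.I_notcarr by (auto simp: S)
    then show ?case by simp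
  next
    case (add v i)
    have iv: "i \<in> {1..n}" "Poly_Mapping.keys v \<subseteq> {1..n}"
      using add.prems by (auto simp: keys_add_nat)
    have cl: "Poly_Mapping.single v 1 \<in> carrier S" "pvar i \<in> carrier S"
      using iv pvar_closed[of i n] by (simp_all add: S single_closed)
    have "Poly_Mapping.single (v + Poly_Mapping.single i 1) (1::'k) = Poly_Mapping.single v 1 \<otimes>\<^bsub>S\<^esub> pvar i"
      by (simp add: S pvar_def mult_single)
    also have "\<dots> \<in> P \<longleftrightarrow> Poly_Mapping.single v 1 \<in> P \<or> pvar i \<in> P"
      using P.I_prime[OF cl] P.I_r_closed[OF _ cl(2)] P.I_l_closed[OF _ cl(1)] by blast
    also have "\<dots> \<longleftrightarrow> Poly_Mapping.keys (v + Poly_Mapping.single i 1) \<inter> C \<noteq> {}"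
      using add.IH[OF iv(2)] iv(1) by (auto simp: keys_add_nat C_def)
    finally show ?case .
  qed
  have "f \<noteq> 0"
  proof
    assume "f = 0"
    then have "P = carrier S"
      using P_iff additive_subgroup.zero_closed[OF ideal.axioms(1)[OF J]] P.Icarr by (auto simp: S)
    then show False using P.I_notcarr by simp
  qed
  then obtain u where u: "u \<in> Poly_Mapping.keys f"
    by (metis keys_eq_empty ex_in_conv)
  show thesis
  proof
    have "Poly_Mapping.keys u \<subseteq> {1..n}"
      using u f(1) by (auto simp: S carrier_polynomial_ring_iff)
    then show "colon_variables n A C"
      unfolding colon_variables_def using colon[OF u] single_P by (auto simp: C_def)
    show "P = variable_ideal n C"
    proof
      show "variable_ideal n C \<subseteq> P"
      proof
        fix p :: "'k mpoly" assume p: "p \<in> variable_ideal n C"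
        show "p \<in> P"
        proof (rule ideal_memI[OF P.is_ideal])
          show "p \<in> carrier S" using p by (simp add: S variable_ideal_def monomial_ideal_def)
          fix m assume "m \<in> Poly_Mapping.keys p"
          then have "Poly_Mapping.keys m \<subseteq> {1..n}" "Poly_Mapping.keys m \<inter> C \<noteq> {}"
            using p by (auto simp: variable_ideal_def monomial_ideal_def carrier_polynomial_ring_iff)
          then show "Poly_Mapping.single m 1 \<in> P" using single_P by blast
        qed
      qed
      \<comment> \<open>\<open>P\<close> is not known to be spanned by monomials. Instead, the part
        \<open>g2\<close> of \<open>g\<close> free of \<open>C\<close> is shown to vanish: every
        monomial of \<open>g2 * f\<close> would lie both in \<open>A\<close> and outside
        \<open>A\<close>, so \<open>g2 * f = 0\<close>.\<close>
      show "P \<subseteq> variable_ideal n C"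
      proof
        fix g assume g: "g \<in> P"
        let ?X = "{m :: nat \<Rightarrow>\<^sub>0 nat. Poly_Mapping.keys m \<inter> C \<noteq> {}}"
        obtain g1 g2 where s: "g = g1 + g2" "Poly_Mapping.keys g1 = Poly_Mapping.keys g \<inter> ?X"
          "Poly_Mapping.keys g2 = Poly_Mapping.keys g - ?X"
          by (rule poly_mapping_split_keys)
        have gS: "g \<in> carrier S" using g P.a_subset by blast
        have g12: "g1 \<in> variable_ideal n C" "g2 \<in> carrier S"
          using gS s by (auto simp: variable_ideal_def monomial_ideal_def S carrier_polynomial_ring_iff)
        have "g1 \<in> P" using g12(1) \<open>variable_ideal n C \<subseteq> P\<close> by blast
        then have "- g1 + g \<in> P"
          using P.a_closed[OF ideal_uminus_closed[OF P.is_ideal] g] by (simp add: S)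
        then have "g2 * f \<in> ?J" using P_iff by (simp add: s(1))
        then have "Poly_Mapping.keys (g2 * f) \<subseteq> A" by (simp add: monomial_ideal_def)
        moreover have "Poly_Mapping.keys (g2 * f) \<subseteq> - A"
        proof
          fix m assume "m \<in> Poly_Mapping.keys (g2 * f)"
          then obtain v w where vw: "m = v + w" "v \<in> Poly_Mapping.keys g2" "w \<in> Poly_Mapping.keys f"
            using Poly_Mapping.keys_mult[of g2 f] by blast
          then have "Poly_Mapping.keys v \<subseteq> {1..n}" "Poly_Mapping.keys v \<inter> C = {}"
            using g12(2) s(3) by (auto simp: S carrier_polynomial_ring_iff)
          then show "m \<in> - A"
            using colon[OF vw(3)] single_P vw(1) by (auto simp: add.commute)
        qed
        ultimately have "Poly_Mapping.keys (g2 * f) = {}" by blast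
        then have "g2 = 0" using \<open>f \<noteq> 0\<close> by simp
        then show "g \<in> variable_ideal n C" using g12(1) s(1) by simp
      qed
    qed
  qed
qed

lemma Ass_monomial_ideal:
  assumes "upward_closed A"
  shows "Ass S (quotient_module S (monomial_ideal n A)) = variable_ideal n ` {C. colon_variables n A C}"
  using colon_variables_imp_Ass[OF assms] by (auto elim: Ass_imp_colon_variables[OF assms])

end


section \<open>Powers of the edge ideal\<close>

text \<open>Each edge is oriented towards its larger vertex; the inequality is then the one that
  survives sorting in \<open>sort_pairs_less\<close>.\<close>

definition anti_path_edges :: "nat \<Rightarrow> nat \<Rightarrow> (nat \<times> nat) set" where
  "anti_path_edges d n = {(i, j). 1 \<le> i \<and> i + d < j \<and> j \<le> n}"

definition packable_exponents :: "(nat \<times> nat) set \<Rightarrow> nat \<Rightarrow> (nat \<Rightarrow>\<^sub>0 nat) set" where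
  "packable_exponents E k = {a. packable E k (Poly_Mapping.lookup a)}"

lemma upward_closed_packable_exponents: "upward_closed (packable_exponents E k)"
  by (auto simp: upward_closed_def packable_exponents_def lookup_add elim!: packable_mono)

lemma packable_exponents_0: "packable_exponents E 0 = UNIV"
  by (auto simp: packable_exponents_def packable_def)

text \<open>Split a packing of \<open>j + k\<close> edges. The second factor takes exactly the
  exponents of its \<open>k\<close> edges, and all surplus exponents go to the first.\<close>

lemma packable_exponents_add:
  "{a + b | a b. a \<in> packable_exponents E j \<and> b \<in> packable_exponents E k}
    = packable_exponents E (j + k)" (is "?L = ?R")
proof
  have "Poly_Mapping.lookup (a + b) = (\<lambda>v. Poly_Mapping.lookup a v + Poly_Mapping.lookup b v)"
    for a b :: "nat \<Rightarrow>\<^sub>0 nat"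
    by (rule ext) (rule lookup_add)
  then show "?L \<subseteq> ?R"
    by (auto simp: packable_exponents_def intro!: packable_add)
  show "?R \<subseteq> ?L"
  proof
    fix c assume "c \<in> ?R"
    then obtain M where M: "size M = j + k" "set_mset M \<subseteq> E"
      "\<And>v. edge_degree M v \<le> Poly_Mapping.lookup c v"
      by (auto simp: packable_exponents_def packable_def)
    obtain es where es: "mset es = M" using ex_mset by blast
    define N P where "N = mset (take j es)" and "P = mset (drop j es)"
    have MNP: "M = N + P"
      unfolding N_def P_def es [symmetric] by (metis append_take_drop_id mset_append)
    have NP: "size N = j" "size P = k"
      using M(1) es by (auto simp: N_def P_def)
    define b :: "nat \<Rightarrow>\<^sub>0 nat" where
      "b = (\<Sum>e\<in>#P. Poly_Mapping.single (fst e) 1 + Poly_Mapping.single (snd e) 1)"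
    have b: "Poly_Mapping.lookup b v = edge_degree P v" for v
      unfolding b_def by (induction P) (auto simp: lookup_add lookup_single when_def)
    have le: "edge_degree N v + edge_degree P v \<le> Poly_Mapping.lookup c v" for v
      using M(3)[of v] by (simp add: MNP)
    have "c = (c - b) + b"
      using add_leD2[OF le] by (intro poly_mapping_eqI) (simp add: lookup_add lookup_minus b)
    moreover have "c - b \<in> packable_exponents E j"
      using NP(1) M(2) MNP le unfolding packable_exponents_def packable_def
      by (intro CollectI exI[of _ N]) (auto simp: lookup_minus b le_diff_conv2 add_leD2[OF le])
    moreover have "b \<in> packable_exponents E k"
      using NP(2) M(2) MNP unfolding packable_exponents_def packable_def
      by (intro CollectI exI[of _ P]) (auto simp: b)
    ultimately show "c \<in> ?L" by blast
  qed
qed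

text \<open>With general \<open>m\<close> this also covers the powers of the square of the edge
  ideal.\<close>

lemma ideal_power_packable_exponents:
  fixes S :: "'k::field mpoly ring"
  assumes S: "S = polynomial_ring n"
  shows "ideal_power S (monomial_ideal n (packable_exponents E m)) k
    = monomial_ideal n (packable_exponents E (m * k))"
proof (induction k)
  case 0
  show ?case
    by (simp add: packable_exponents_0 monomial_ideal_def ideals_set_def nat_pow_def S)
next
  case (Suc k)
  have "ideal_power S (monomial_ideal n (packable_exponents E m)) (Suc k)
    = ideal_prod S (monomial_ideal n (packable_exponents E (m * k)))
        (monomial_ideal n (packable_exponents E m))"
    using Suc by (simp add: nat_pow_def ideals_set_def)
  also have "\<dots> = monomial_ideal n (packable_exponents E (m * k + m))"
    by (simp add: ideal_prod_monomial_ideal[OF S] upward_closed_packable_exponents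
        packable_exponents_add)
  finally show ?case by (simp add: add.commute)
qed

lemma edge_ideal_eq_monomial_ideal:
  assumes "n \<ge> d + 1"
  shows "(edge_ideal n (anti_d_path d n) :: 'k::field mpoly set)
    = monomial_ideal n (packable_exponents (anti_path_edges d n) 1)" (is "_ = ?M")
proof -
  define S :: "'k mpoly ring" where "S = polynomial_ring n"
  interpret S: cring S unfolding S_def by (rule polynomial_ring_cring)
  define G :: "'k mpoly set" where
    "G = {pvar i \<otimes>\<^bsub>S\<^esub> pvar j | i j. i \<in> {1..n} \<and> j \<in> {1..n} \<and> i + d < j}"
  have "(pvar i :: 'k mpoly) \<in> carrier S" if "i \<in> {1..n}" for i
    using that pvar_closed[of i n] by (simp add: S_def)
  then have G: "G \<subseteq> carrier S"
    unfolding G_def by blast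
  note gen = S.genideal_ideal[OF G]
  have "Idl\<^bsub>S\<^esub> G = ?M"
  proof
    have "G \<subseteq> ?M"
    proof
      fix p assume "p \<in> G"
      then obtain i j where ij: "i \<in> {1..n}" "j \<in> {1..n}" "i + d < j" "p = pvar i * pvar j"
        by (auto simp: G_def S_def)
      let ?m = "Poly_Mapping.single i 1 + Poly_Mapping.single j (1::nat)"
      have "packable (anti_path_edges d n) 1 (Poly_Mapping.lookup ?m)"
        using ij by (intro packable_replicate[of "(i, j)"])
          (auto simp: anti_path_edges_def lookup_add)
      moreover have "Poly_Mapping.keys ?m \<subseteq> {1..n}" using ij by (simp add: keys_add_nat)
      ultimately show "p \<in> ?M"
        unfolding ij(4) pvar_def mult_single
        by (simp add: single_mem_monomial_ideal_iff[OF refl] packable_exponents_def)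
    qed
    then show "Idl\<^bsub>S\<^esub> G \<subseteq> ?M"
      by (intro S.genideal_minimal monomial_ideal_is_ideal[OF S_def] upward_closed_packable_exponents)
    show "?M \<subseteq> Idl\<^bsub>S\<^esub> G"
    proof
      fix p assume p: "p \<in> ?M"
      show "p \<in> Idl\<^bsub>S\<^esub> G"
      proof (rule ideal_memI[OF S_def gen])
        show "p \<in> carrier S" using p by (simp add: S_def monomial_ideal_def)
        fix m assume m: "m \<in> Poly_Mapping.keys p"
        then have "packable (anti_path_edges d n) 1 (Poly_Mapping.lookup m)"
          using p by (auto simp: monomial_ideal_def packable_exponents_def)
        then obtain i j where e: "(i, j) \<in> anti_path_edges d n"
          and deg: "\<And>v. edge_degree {#(i, j)#} v \<le> Poly_Mapping.lookup m v"
          unfolding packable_def by (metis One_nat_def insert_subset set_mset_add_mset_insert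
              size_1_singleton_mset surj_pair)
        let ?e = "Poly_Mapping.single i 1 + Poly_Mapping.single j (1::nat)"
        have m_eq: "m = (m - ?e) + ?e"
        proof (rule poly_mapping_eqI)
          fix v show "Poly_Mapping.lookup m v = Poly_Mapping.lookup ((m - ?e) + ?e) v"
            using deg[of v] by (auto simp: lookup_add lookup_minus lookup_single when_def split: if_splits)
        qed
        have "Poly_Mapping.keys m \<subseteq> {1..n}"
          using p m by (auto simp: monomial_ideal_def carrier_polynomial_ring_iff)
        then have "Poly_Mapping.keys (m - ?e) \<subseteq> {1..n}"
          using m_eq keys_add_nat[of "m - ?e" ?e] by auto
        then have "Poly_Mapping.single (m - ?e) (1::'k) \<in> carrier S"
          by (simp add: S_def single_closed)
        moreover have "pvar i \<otimes>\<^bsub>S\<^esub> pvar j \<in> Idl\<^bsub>S\<^esub> G"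
          using S.genideal_self[OF G] e by (force simp: G_def anti_path_edges_def)
        ultimately have "Poly_Mapping.single (m - ?e) (1::'k) \<otimes>\<^bsub>S\<^esub> (pvar i \<otimes>\<^bsub>S\<^esub> pvar j) \<in> Idl\<^bsub>S\<^esub> G"
          using ideal.I_l_closed[OF gen] by blast
        then show "Poly_Mapping.single m 1 \<in> Idl\<^bsub>S\<^esub> G"
          using m_eq by (simp add: S_def pvar_def mult_single)
      qed
    qed
  qed
  then show ?thesis
    by (simp add: edge_ideal_anti_d_path[OF assms] G_def S_def)
qed


section \<open>Colon ideals of powers\<close>

definition minimal_cover :: "nat set \<Rightarrow> (nat \<times> nat) set \<Rightarrow> nat set \<Rightarrow> bool" where
  "minimal_cover V E C \<longleftrightarrow> C \<subseteq> V \<and> (\<forall>(i, j)\<in>E. i \<in> C \<or> j \<in> C) \<and>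
    (\<forall>c\<in>C. \<exists>z\<in>V - C. (c, z) \<in> E \<or> (z, c) \<in> E)"

lemma exists_exponent:
  assumes "finite V"
  obtains u where "Poly_Mapping.keys u \<subseteq> V"
    "Poly_Mapping.lookup u = (\<lambda>v. if v \<in> V then f v else 0 :: nat)"
proof
  let ?u = "\<Sum>v\<in>V. Poly_Mapping.single v (f v)"
  show "Poly_Mapping.lookup ?u = (\<lambda>v. if v \<in> V then f v else 0)"
    using assms by (auto simp: lookup_sum lookup_single when_def)
  then show "Poly_Mapping.keys ?u \<subseteq> V"
    by (auto simp: in_keys_iff split: if_splits)
qed

text \<open>The witness has exponent \<open>k\<close> outside \<open>C\<close> and only
  \<open>k - 1\<close> in total on \<open>C\<close>. A cover bounds every packing by the total on
  it, so \<open>k\<close> edges do not fit; one more unit in \<open>C\<close> makes the total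
  \<open>k\<close>, and each unit is matched to a neighbour outside.\<close>

lemma minimal_cover_imp_colon_variables:
  assumes C: "minimal_cover {1..n} E C" and k: "k \<ge> 1"
  shows "colon_variables n (packable_exponents E k) C"
proof (cases "C = {}")
  case True
  \<comment> \<open>An empty cover forces the zero ideal, and the colon ideal of the monomial
    \<open>1\<close> is then the zero prime.\<close>
  then have "E = {}" using C by (auto simp: minimal_cover_def)
  then have "\<not> packable E k u" for u using k by (auto simp: packable_def)
  then show ?thesis
    using True by (auto simp: colon_variables_def packable_exponents_def intro: exI[of _ 0])
next
  case False
  then obtain c0 where c0: "c0 \<in> C" by blast
  have CV: "C \<subseteq> {1..n}" and cover: "\<And>e. e \<in> E \<Longrightarrow> fst e \<in> C \<or> snd e \<in> C"
    and nbr: "\<And>c. c \<in> C \<Longrightarrow> \<exists>z\<in>{1..n} - C. (c, z) \<in> E \<or> (z, c) \<in> E"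
    using C by (auto simp: minimal_cover_def)
  have fin: "finite C" using CV finite_subset by blast
  obtain u where u: "Poly_Mapping.keys u \<subseteq> {1..n}" "Poly_Mapping.lookup u =
      (\<lambda>v. if v \<in> {1..n} then (if v \<in> C then (if v = c0 then k - 1 else 0) else k) else 0)"
    using exists_exponent[of "{1..n}" "\<lambda>v. if v \<in> C then (if v = c0 then k - 1 else 0) else k"]
    by auto
  have "u + v \<in> packable_exponents E k \<longleftrightarrow> Poly_Mapping.keys v \<inter> C \<noteq> {}" for v
  proof
    assume "u + v \<in> packable_exponents E k"
    then obtain M where M: "size M = k" "set_mset M \<subseteq> E"
      "\<And>x. edge_degree M x \<le> Poly_Mapping.lookup (u + v) x"
      by (auto simp: packable_exponents_def packable_def)
    show "Poly_Mapping.keys v \<inter> C \<noteq> {}"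
    proof
      assume "Poly_Mapping.keys v \<inter> C = {}"
      then have *: "Poly_Mapping.lookup (u + v) c = (if c = c0 then k - 1 else 0)" if "c \<in> C" for c
        using that CV u(2) by (auto simp: lookup_add in_keys_iff)
      have "k \<le> (\<Sum>c\<in>C. edge_degree M c)"
        using size_le_sum_edge_degree[OF fin, of M] cover M(1,2) by blast
      also have "\<dots> \<le> (\<Sum>c\<in>C. Poly_Mapping.lookup (u + v) c)"
        by (intro sum_mono M(3))
      also have "\<dots> = k - 1"
        using fin c0 by (simp add: * cong: sum.cong)
      finally show False using k by simp
    qed
  next
    assume "Poly_Mapping.keys v \<inter> C \<noteq> {}"
    then obtain c where "c \<in> C" "c \<in> Poly_Mapping.keys v" by blast
    then have c: "c \<in> C" "Poly_Mapping.lookup v c > 0" by (simp_all add: in_keys_iff)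
    define w where "w x = (if x = c0 then k - 1 else 0) + (if x = c then 1 else (0::nat))" for x
    have sum_w: "sum w C = k"
      using fin c0 c(1) k by (simp add: w_def sum.distrib)
    have "packable E k (\<lambda>x. (if x \<in> C then w x else 0) + (if x \<in> {1..n} - C then k else 0))"
      using packable_star_sum[OF fin nbr, of w] unfolding sum_w .
    moreover have "(if x \<in> C then w x else 0) + (if x \<in> {1..n} - C then k else 0)
      \<le> Poly_Mapping.lookup (u + v) x" for x
      using CV c c0 by (auto simp: lookup_add u(2) w_def)
    ultimately show "u + v \<in> packable_exponents E k"
      unfolding packable_exponents_def by (intro CollectI) (rule packable_mono)
  qed
  then show ?thesis
    using CV u(1) unfolding colon_variables_def by blast
qed

text \<open>The vertices of \<open>C\<close> with a neighbour outside \<open>C\<close> can always be matched to it, since the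
  outside exponents may be taken large. What remains to be packed lives on the other vertices \<open>D\<close>
  of \<open>C\<close>. They span a bipartite graph: a vertex \<open>z \<notin> C\<close> is adjacent to none of them, so
  they lie within distance \<open>d\<close> of \<open>z\<close>, and adjacent ones are on different sides of \<open>z\<close>.\<close>

lemma colon_variables_imp_minimal_cover:
  fixes d n k :: nat
  defines "E \<equiv> anti_path_edges d n"
  assumes colon: "colon_variables n (packable_exponents E k) C"
    and small: "C \<noteq> {1..n} \<or> n < 2 * d + 3"
  shows "minimal_cover {1..n} E C"
proof -
  let ?Z = "{1..n} - C"
  obtain u where CV: "C \<subseteq> {1..n}" and u: "Poly_Mapping.keys u \<subseteq> {1..n}"
    "\<And>v. Poly_Mapping.keys v \<subseteq> {1..n} \<Longrightarrow>
      u + v \<in> packable_exponents E k \<longleftrightarrow> Poly_Mapping.keys v \<inter> C \<noteq> {}"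
    using colon by (auto simp: colon_variables_def)
  have fin: "finite C" using CV finite_subset by blast
  \<comment> \<open>Multiplying by variables outside \<open>C\<close> leaves the colon ideal
    unchanged, so \<open>u\<close> may be raised there by \<open>K\<close>, which leaves room for
    \<open>k\<close> edges and for matching all units of \<open>u\<close> on
    \<open>C\<close>.\<close>
  define K where "K = k + (\<Sum>x\<in>{1..n}. Poly_Mapping.lookup u x)"
  obtain y where y: "Poly_Mapping.keys y \<subseteq> ?Z"
    "Poly_Mapping.lookup y = (\<lambda>v. if v \<in> ?Z then K else 0)"
    using exists_exponent[of ?Z "\<lambda>_. K"] by auto
  define w where "w = Poly_Mapping.lookup (u + y)"
  have wC: "w c = Poly_Mapping.lookup u c" if "c \<in> C" for c
    using that by (simp add: w_def lookup_add y(2))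
  have wZ: "K \<le> w z" if "z \<in> ?Z" for z
    using that by (simp add: w_def lookup_add y(2))
  have not_w: "\<not> packable E k w"
    using u(2)[of y] y(1) by (auto simp: w_def packable_exponents_def)
  have w_inc: "packable E k (w(c := w c + 1))" if "c \<in> C" for c
  proof -
    have "u + (y + Poly_Mapping.single c 1) \<in> packable_exponents E k"
      using that y(1) CV by (subst u(2)) (auto simp: keys_add_nat)
    moreover have "Poly_Mapping.lookup (u + (y + Poly_Mapping.single c 1)) = w(c := w c + 1)"
      by (auto simp: w_def lookup_add lookup_single when_def)
    ultimately show ?thesis by (simp add: packable_exponents_def)
  qed
  have edge: "i < j \<and> i \<in> {1..n} \<and> j \<in> {1..n}" if "(i, j) \<in> E" for i j
    using that by (auto simp: E_def anti_path_edges_def)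
  \<comment> \<open>An edge outside \<open>C\<close> could be repeated \<open>k\<close> times, as
    both ends have capacity at least \<open>K\<close>.\<close>
  have cover: "i \<in> C \<or> j \<in> C" if ij: "(i, j) \<in> E" for i j
  proof (rule ccontr)
    assume "\<not> ?thesis"
    then have "i \<in> ?Z" "j \<in> ?Z" using edge[OF ij] by auto
    then have "k \<le> w i" "k \<le> w j" using wZ by (auto simp: K_def intro: le_trans[OF le_add1])
    then have "packable E k w"
      using ij edge[OF ij] by (intro packable_replicate[of "(i, j)"]) auto
    with not_w show False ..
  qed
  define W where "W = {c \<in> C. \<exists>z\<in>?Z. (c, z) \<in> E \<or> (z, c) \<in> E}"
  define D where "D = C - W"
  have "D = {}"
  proof (rule ccontr)
    assume D: "D \<noteq> {}"
    obtain A B where AB: "A \<union> B = D" "A \<inter> B = {}"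
      and bip: "\<And>i j. (i, j) \<in> E \<Longrightarrow> i \<in> D \<Longrightarrow> j \<in> D \<Longrightarrow> i \<in> A \<and> j \<in> B"
    proof (cases "C = {1..n}")
      case True
      then have n: "n < 2 * d + 3" using small by simp
      show thesis
      \<comment> \<open>An edge has \<open>i + d < j \<le> n \<le> 2 * d + 2\<close>, hence
        \<open>i \<le> d + 1 < j\<close>.\<close>
      proof (rule that[of "{x \<in> D. x \<le> d + 1}" "{x \<in> D. x > d + 1}"])
        fix i j assume "(i, j) \<in> E" "i \<in> D" "j \<in> D"
        then show "i \<in> {x \<in> D. x \<le> d + 1} \<and> j \<in> {x \<in> D. x > d + 1}"
          using n by (auto simp: E_def anti_path_edges_def)
      qed auto
    next
      case False
      then obtain z where z: "z \<in> ?Z" using CV by blast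
      have near: "z \<le> x + d \<and> x \<le> z + d \<and> x \<noteq> z" if x: "x \<in> D" for x
      proof -
        have "x \<in> C" "(x, z) \<notin> E" "(z, x) \<notin> E" using x z by (auto simp: D_def W_def)
        then show ?thesis using z CV by (auto simp: E_def anti_path_edges_def not_less)
      qed
      show thesis
      proof (rule that[of "{x \<in> D. x < z}" "{x \<in> D. x > z}"])
        fix i j assume "(i, j) \<in> E" "i \<in> D" "j \<in> D"
        then show "i \<in> {x \<in> D. x < z} \<and> j \<in> {x \<in> D. x > z}"
          using near[of i] near[of j] by (auto simp: E_def anti_path_edges_def)
      qed (use near in \<open>auto simp: neq_iff\<close>)
    qed
    define E' where "E' = {(i, j). i \<in> A \<and> j \<in> B \<and> i + d < j}"
    have DC: "D \<subseteq> C" by (auto simp: D_def)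
    have E'E: "E' \<subseteq> E"
      using AB DC CV by (auto simp: E'_def E_def anti_path_edges_def)
    have finW: "finite W" using fin by (auto simp: W_def)
    define s where "s = sum w W"
    have sK: "s \<le> K"
    proof -
      have "s = (\<Sum>x\<in>W. Poly_Mapping.lookup u x)"
        unfolding s_def by (intro sum.cong) (auto simp: W_def wC)
      also have "\<dots> \<le> (\<Sum>x\<in>{1..n}. Poly_Mapping.lookup u x)"
        using CV by (intro sum_mono2) (auto simp: W_def)
      finally show ?thesis by (simp add: K_def)
    qed
    have star: "packable E s (\<lambda>v. (if v \<in> W then w v else 0) + (if v \<in> ?Z then s else 0))"
      unfolding s_def using finW by (intro packable_star_sum) (auto simp: W_def)
    \<comment> \<open>A packing inside \<open>D\<close> is completed by \<open>s\<close> star edges,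
      one for each unit on \<open>W\<close>. Since \<open>k - s\<close> is truncated, the total is
      only known to be at least \<open>k\<close>.\<close>
    have combine: "packable E k w" if p: "packable E' (k - s) w"
    proof -
      obtain M where M: "size M = k - s" "set_mset M \<subseteq> E'" "\<And>v. edge_degree M v \<le> w v"
        using p by (auto simp: packable_def)
      have "edge_degree M v = 0" if "v \<notin> D" for v
      proof (rule ccontr)
        assume "edge_degree M v \<noteq> 0"
        then obtain e where "e \<in># M" "fst e = v \<or> snd e = v" by (auto simp: edge_degree_pos_iff)
        then show False using M(2) that AB(1) by (auto simp: E'_def)
      qed
      then have "edge_degree M v \<le> (if v \<in> D then w v else 0)" for v
        using M(3)[of v] by simp
      then have "packable E' (k - s) (\<lambda>v. if v \<in> D then w v else 0)"
        using M(1,2) unfolding packable_def by blast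
      from packable_add[OF this star E'E order_refl]
      have "packable E (k - s + s) w"
      proof (rule packable_mono)
        fix v
        have "v \<in> D \<Longrightarrow> v \<notin> W \<and> v \<notin> ?Z" "v \<in> W \<Longrightarrow> v \<notin> ?Z" by (auto simp: D_def W_def)
        then show "(if v \<in> D then w v else 0) + ((if v \<in> W then w v else 0) + (if v \<in> ?Z then s else 0)) \<le> w v"
          using wZ[of v] sK by (cases "v \<in> D"; cases "v \<in> W"; cases "v \<in> ?Z") (simp_all del: Diff_iff)
      qed
      then show ?thesis by (rule packable_le) simp
    qed
    have "s < k"
    proof (rule ccontr)
      assume "\<not> s < k"
      then have "packable E' (k - s) w" by (auto simp: packable_def)
      with combine not_w show False by blast
    qed
    then obtain r where r: "k - s = r + 1"
      by (metis Suc_eq_plus1 Suc_diff_Suc)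
    \<comment> \<open>An extra unit at \<open>c \<in> D\<close> makes \<open>k\<close> edges fit.
      Those not inside \<open>D\<close> meet \<open>W\<close>, where the capacity is only
      \<open>s\<close>, so at least \<open>r + 1\<close> edges lie inside \<open>D\<close>.\<close>
    have inc: "packable E' (r + 1) (w(c := w c + 1))" if c: "c \<in> A \<union> B" for c
    proof -
      have cD: "c \<in> D" using c AB(1) by simp
      obtain M where M: "size M = k" "set_mset M \<subseteq> E"
        "\<And>v. edge_degree M v \<le> (w(c := w c + 1)) v"
        using w_inc[of c] cD DC by (auto simp: packable_def)
      define N where "N = filter_mset (\<lambda>e. fst e \<in> D \<and> snd e \<in> D) M"
      define P where "P = filter_mset (\<lambda>e. \<not> (fst e \<in> D \<and> snd e \<in> D)) M"
      have MNP: "M = N + P" unfolding N_def P_def by (rule multiset_partition)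
      have "fst e \<in> W \<or> snd e \<in> W" if "e \<in># P" for e
      proof -
        obtain i j where e: "e = (i, j)" by (cases e)
        have ij: "(i, j) \<in> E" "\<not> (i \<in> D \<and> j \<in> D)" using that M(2) e by (auto simp: P_def)
        then show ?thesis
          using cover[OF ij(1)] edge[OF ij(1)] e by (auto simp: D_def W_def)
      qed
      then have "size P \<le> (\<Sum>x\<in>W. edge_degree P x)"
        by (rule size_le_sum_edge_degree[OF finW])
      also have "\<dots> \<le> s"
        unfolding s_def
      proof (rule sum_mono)
        fix x assume "x \<in> W"
        then have "x \<noteq> c" using cD by (auto simp: D_def)
        then show "edge_degree P x \<le> w x" using M(3)[of x] by (simp add: MNP)
      qed
      finally have "size P \<le> s" .
      then have "r + 1 \<le> size N" using M(1) r by (simp add: MNP)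
      moreover have "packable E' (size N) (w(c := w c + 1))"
        unfolding packable_def
      proof (intro exI conjI allI)
        show "edge_degree N v \<le> (w(c := w c + 1)) v" for v
          using M(3)[of v] unfolding MNP by simp
        show "set_mset N \<subseteq> E'"
        proof
          fix e assume "e \<in># N"
          moreover obtain i j where e: "e = (i, j)" by (cases e)
          ultimately have ij: "(i, j) \<in> E" "i \<in> D" "j \<in> D" using M(2) by (auto simp: N_def)
          then have "i + d < j" by (simp add: E_def anti_path_edges_def)
          with bip[OF ij] show "e \<in> E'" by (simp add: E'_def e)
        qed
      qed simp
      ultimately show ?thesis by (rule packable_le[rotated])
    qed
    have finA: "finite A" using fin DC AB(1) by (metis finite_Un rev_finite_subset)
    have ne: "A \<union> B \<noteq> {}" using AB(1) D by simp
    have "packable E' (r + 1) w"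
      unfolding E'_def
      by (rule bipartite_packing_not_increasing_everywhere[OF finA AB(2) ne inc[unfolded E'_def]])
    with combine r not_w show False by simp
  qed
  then have "W = C" by (auto simp: D_def W_def)
  then have "\<exists>z\<in>?Z. (c, z) \<in> E \<or> (z, c) \<in> E" if "c \<in> C" for c
    using that unfolding W_def by blast
  with CV cover show ?thesis
    unfolding minimal_cover_def by blast
qed

text \<open>The witness is the triangle \<open>1, d + 2, n\<close>, which contains a neighbour of every vertex, times a
  power of its edge \<open>{1, n}\<close>.\<close>

lemma maximal_ideal_colon_variables:
  assumes n: "2 * d + 3 \<le> n" and k: "k \<ge> 2"
  shows "colon_variables n (packable_exponents (anti_path_edges d n) k) {1..n}"
proof -
  let ?E = "anti_path_edges d n"
  obtain u where u: "Poly_Mapping.keys u \<subseteq> {1..n}" "Poly_Mapping.lookup u =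
      (\<lambda>v. if v \<in> {1..n} then (if v = 1 then k - 1 else 0) + (if v = d + 2 then 1 else 0)
        + (if v = n then k - 1 else 0) else 0)"
    using exists_exponent[of "{1..n}" "\<lambda>v. (if v = 1 then k - 1 else 0) + (if v = d + 2 then 1 else 0)
        + (if v = n then k - 1 else 0)"] by auto
  have "u + v \<in> packable_exponents ?E k \<longleftrightarrow> Poly_Mapping.keys v \<inter> {1..n} \<noteq> {}"
    if v: "Poly_Mapping.keys v \<subseteq> {1..n}" for v
  proof
    assume p: "u + v \<in> packable_exponents ?E k"
    show "Poly_Mapping.keys v \<inter> {1..n} \<noteq> {}"
    proof
      assume "Poly_Mapping.keys v \<inter> {1..n} = {}"
      then have "v = 0" using v by (metis inf.absorb1 keys_eq_empty)
      then obtain M where M: "size M = k" "set_mset M \<subseteq> ?E"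
        "\<And>x. edge_degree M x \<le> Poly_Mapping.lookup u x"
        using p by (auto simp: packable_exponents_def packable_def)
      \<comment> \<open>The exponents of \<open>u\<close> sum to \<open>2 * k - 1\<close>, one less
        than the total degree of \<open>k\<close> edges.\<close>
      have "2 * k = (\<Sum>x\<in>{1..n}. edge_degree M x)"
        using M(1,2) by (subst sum_edge_degree_total) (auto simp: anti_path_edges_def)
      also have "\<dots> \<le> (\<Sum>x\<in>{1..n}. Poly_Mapping.lookup u x)"
        by (intro sum_mono M(3))
      also have "\<dots> = 2 * k - 1"
        using n k by (simp add: u(2) sum.distrib)
      finally show False using k by simp
    qed
  next
    assume "Poly_Mapping.keys v \<inter> {1..n} \<noteq> {}"
    then obtain x where "x \<in> {1..n}" "x \<in> Poly_Mapping.keys v" by blast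
    then have x: "x \<in> {1..n}" "Poly_Mapping.lookup v x > 0" by (simp_all add: in_keys_iff)
    \<comment> \<open>An extra vertex \<open>x \<le> d + 1\<close> is joined to \<open>n\<close>,
      any other to \<open>1\<close>; the remaining two vertices of the triangle form the second
      edge.\<close>
    let ?M = "replicate_mset (k - 2) (1, n)
      + (if x \<le> d + 1 then {#(x, n), (1, d + 2)#} else {#(1, x), (d + 2, n)#})"
    have "set_mset ?M \<subseteq> ?E"
      using n x(1) by (auto simp: anti_path_edges_def)
    moreover have "size ?M = k" using k by simp
    moreover have "edge_degree ?M y \<le> Poly_Mapping.lookup (u + v) y" for y
      using n k x by (auto simp: lookup_add u(2))
    ultimately show "u + v \<in> packable_exponents ?E k"
      unfolding packable_exponents_def packable_def by blast
  qed
  then show ?thesis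
    using u(1) unfolding colon_variables_def by blast
qed

theorem theorem3p7:
  fixes d n :: nat
    and S :: "'k::field mpoly ring"
    and I :: "'k mpoly set"
  assumes "d \<ge> 1" and "n \<ge> d + 1"
    and "S = polynomial_ring n"
    and "I = edge_ideal n (anti_d_path d n)"
  shows "(\<forall>k>1. Ass S (quotient_module S (ideal_power S I k)) =
            (if d + 2 > n - d - 1 then Ass S (quotient_module S I)
             else Ass S (quotient_module S I) \<union> {Idl\<^bsub>S\<^esub> (pvar ` {1..n})}))
       \<and> (d + 2 > n - d - 1 \<longrightarrow> normally_torsion_free S I)
       \<and> (d + 2 \<le> n - d - 1 \<longrightarrow> normally_torsion_free S (ideal_power S I 2))"
proof -
  define E where "E = anti_path_edges d n"
  define J :: "nat \<Rightarrow> 'k mpoly set" where "J k = monomial_ideal n (packable_exponents E k)" for k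
  define Covers :: "'k mpoly set set" where "Covers = variable_ideal n ` {C. minimal_cover {1..n} E C}"
  define \<mm> :: "'k mpoly set" where "\<mm> = variable_ideal n {1..n}"
  have I: "I = J 1"
    using assms by (simp add: edge_ideal_eq_monomial_ideal J_def E_def)
  have J_power: "ideal_power S (J m) k = J (m * k)" for m k
    unfolding J_def by (rule ideal_power_packable_exponents) fact
  have \<mm>: "Idl\<^bsub>S\<^esub> (pvar ` {1..n}) = \<mm>"
    unfolding \<mm>_def by (rule variable_ideal_eq_genideal[symmetric]) (use assms in auto)
  have Ass_J: "Ass S (quotient_module S (J k))
      = variable_ideal n ` {C. colon_variables n (packable_exponents E k) C}" for k
    unfolding J_def by (intro Ass_monomial_ideal assms upward_closed_packable_exponents)
  have Covers_sub: "Covers \<subseteq> Ass S (quotient_module S (J k))" if "k \<ge> 1" for k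
    unfolding Covers_def Ass_J using minimal_cover_imp_colon_variables[OF _ that] by blast
  \<comment> \<open>Only \<open>C = {1..n}\<close> with \<open>n \<ge> 2 * d + 3\<close> escapes the
    cover lemma, and it gives the maximal ideal.\<close>
  have sub_Covers: "Ass S (quotient_module S (J k)) \<subseteq> Covers \<union> (if n < 2 * d + 3 then {} else {\<mm>})" for k
  proof
    fix P assume "P \<in> Ass S (quotient_module S (J k))"
    then obtain C where C: "colon_variables n (packable_exponents E k) C" "P = variable_ideal n C"
      unfolding Ass_J by blast
    show "P \<in> Covers \<union> (if n < 2 * d + 3 then {} else {\<mm>})"
    proof (cases "C \<noteq> {1..n} \<or> n < 2 * d + 3")
      case True
      then have "minimal_cover {1..n} E C"
        unfolding E_def using C(1) by (intro colon_variables_imp_minimal_cover) (simp_all only: E_def)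
      then show ?thesis unfolding Covers_def C(2) by (intro UnI1 imageI CollectI)
    next
      case False
      then show ?thesis by (simp add: C(2) \<mm>_def)
    qed
  qed
  show ?thesis
  proof (cases "n < 2 * d + 3")
    case True
    have cov: "Ass S (quotient_module S (J k)) = Covers" if "k \<ge> 1" for k
      using Covers_sub[OF that] sub_Covers[of k] True by simp
    \<comment> \<open>By \<open>n \<ge> d + 1\<close> the subtraction is not truncated, so this is
      just \<open>n < 2 * d + 3\<close>.\<close>
    have "d + 2 > n - d - 1" using True assms(2) by arith
    then show ?thesis
      unfolding I J_power normally_torsion_free_def by (simp add: cov)
  next
    case False
    have sub: "Ass S (quotient_module S (J k)) \<subseteq> Covers \<union> {\<mm>}" for k
      using sub_Covers[of k] False by simp
    have large: "Ass S (quotient_module S (J k)) = Covers \<union> {\<mm>}" if "k \<ge> 2" for k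
    proof -
      have "\<mm> \<in> Ass S (quotient_module S (J k))"
        unfolding \<mm>_def Ass_J E_def using False maximal_ideal_colon_variables[OF _ that] by simp
      then show ?thesis
        using Covers_sub[OF order_trans[OF _ that]] sub[of k] by (intro equalityI) simp_all
    qed
    have one: "Ass S (quotient_module S (J 1)) \<union> {\<mm>} = Covers \<union> {\<mm>}"
      using Covers_sub[of 1] sub[of 1] by (intro equalityI) auto
    have not_less: "\<not> d + 2 > n - d - 1" using False assms(2) by arith
    show ?thesis
      unfolding I J_power \<mm> normally_torsion_free_def if_not_P[OF not_less] one
    proof (intro conjI allI impI)
      fix k :: nat assume "k > 1"
      then show "Ass S (quotient_module S (J (1 * k))) = Covers \<union> {\<mm>}"
        by (intro large) simp
    next
      \<comment> \<open>The \<open>k\<close>-th power of \<open>J 2\<close> is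
        \<open>J (2 * k)\<close>, and from exponent \<open>2\<close> on the associated primes are
        constant.\<close>
      fix k :: nat assume "k \<ge> 1"
      then have "2 * k \<ge> 2" by simp
      then show "Ass S (quotient_module S (J (1 * 2))) = Ass S (quotient_module S (J (1 * 2 * k)))"
        by (simp add: large)
    qed (use not_less in blast)
  qed
qed

end
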